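(* Let $A=\mathbb{C}[x,y,z]$, let $s,t\in A\setminus\{0\}$ be coprime and equip $A$ with the Poisson bracket determined by $\{x,y\}=t s_z-s t_z$, $\{y,z\}=t s_x-s t_x$, $\{z,x\}=t s_y-s t_y$ (subscripts denote partial derivatives). For $(\lambda,\mu)\in\mathbb{P}^1(\mathbb{C})$ put $f_{\lambda,\mu}=\lambda s-\mu t$. Then the Poisson primitive ideals of $A$ are exactly: (i) the Poisson maximal ideals, namely the maximal ideals $\langle x-\alpha,y-\beta,z-\gamma\rangle$ such that either $p=(\alpha,\beta,\gamma)$ is a common zero of $s$ and $t$, or $p$ is a singular point of $f_{\lambda,\mu}$ for some $(\lambda,\mu)\in\mathbb{P}^1(\mathbb{C})$; and (ii) the ideals $uA$ where $u$ is an irreducible factor, of multiplicity one, of $f_{\lambda,\mu}$ for some $(\lambda,\mu)\in\mathbb{P}^1(\mathbb{C})$ for which $f_{\lambda,\mu}$ is a non-zero non-unit. Moreover $A$ satisfies the Poisson Dixmier–Moeglin equivalence.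
   Context: A Poisson ideal is an ideal $I$ with $\{a,I\}\subseteq I$ for all $a$; a Poisson prime ideal is a Poisson ideal that is prime. The Poisson core of an ideal $I$ is the largest Poisson ideal contained in $I$; a Poisson prime ideal is Poisson primitive if it is the Poisson core of a maximal ideal. A Poisson maximal ideal is a maximal ideal that is a Poisson ideal. A Poisson prime $P$ is locally closed if it is not the intersection of the Poisson prime ideals strictly containing it, and rational if the Poisson centre of the quotient field $Q(A/P)$ (with the induced bracket) is $\mathbb{C}$. The Poisson Dixmier–Moeglin equivalence means that for Poisson prime ideals, locally closed, Poisson primitive and rational are equivalent. A point $p$ is a singular point of a polynomial $f$ if $f(p)=0$ and $f_x(p)=f_y(p)=f_z(p)=0$. $(\lambda,\mu)\in\mathbb{P}^1(\mathbb{C})$ means $(\lambda,\mu)\in\mathbb{C}^2\setminus\{0\}$ up to nonzero scalar. *)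

theory Defs
  imports "HOL-Computational_Algebra.Computational_Algebra" "HOL-Computational_Algebra.Field_as_Ring"
begin

text \<open>A = C[x,y,z] is represented as nested univariate polynomials:
  complex poly poly poly; the innermost variable is x, the middle one y,
  the outermost one z.\<close>

type_synonym cpoly3 = "complex poly poly poly"

definition const3 :: "complex \<Rightarrow> cpoly3" where
  "const3 c = [:[:[:c:]:]:]"

definition varX :: cpoly3 where "varX = [:[:[:0, 1:]:]:]"
definition varY :: cpoly3 where "varY = [:[:0, 1:]:]"
definition varZ :: cpoly3 where "varZ = [:0, 1:]"

definition dX :: "cpoly3 \<Rightarrow> cpoly3" where "dX f = map_poly (map_poly pderiv) f"
definition dY :: "cpoly3 \<Rightarrow> cpoly3" where "dY f = map_poly pderiv f"
definition dZ :: "cpoly3 \<Rightarrow> cpoly3" where "dZ f = pderiv f"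

definition eval3 :: "cpoly3 \<Rightarrow> complex \<Rightarrow> complex \<Rightarrow> complex \<Rightarrow> complex" where
  "eval3 f \<alpha> \<beta> \<gamma> = poly (poly (poly f [:[:\<gamma>:]:]) [:\<beta>:]) \<alpha>"

text \<open>The Poisson bracket with {x,y} = t s_z - s t_z, {y,z} = t s_x - s t_x,
  {z,x} = t s_y - s t_y, extended by the Leibniz rule:
  {f,g} = sum_{i,j} f_i g_j {x_i,x_j}.\<close>
definition pbr :: "cpoly3 \<Rightarrow> cpoly3 \<Rightarrow> cpoly3 \<Rightarrow> cpoly3 \<Rightarrow> cpoly3" where
  "pbr s t f g =
     (dX f * dY g - dY f * dX g) * (t * dZ s - s * dZ t)
   + (dY f * dZ g - dZ f * dY g) * (t * dX s - s * dX t)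
   + (dZ f * dX g - dX f * dZ g) * (t * dY s - s * dY t)"

definition is_ideal :: "cpoly3 set \<Rightarrow> bool" where
  "is_ideal I \<longleftrightarrow> 0 \<in> I \<and> (\<forall>a\<in>I. \<forall>b\<in>I. a + b \<in> I) \<and> (\<forall>r. \<forall>a\<in>I. r * a \<in> I)"

definition is_prime_ideal :: "cpoly3 set \<Rightarrow> bool" where
  "is_prime_ideal I \<longleftrightarrow> is_ideal I \<and> I \<noteq> UNIV \<and> (\<forall>a b. a * b \<in> I \<longrightarrow> a \<in> I \<or> b \<in> I)"

definition is_maximal_ideal :: "cpoly3 set \<Rightarrow> bool" where
  "is_maximal_ideal I \<longleftrightarrow> is_ideal I \<and> I \<noteq> UNIV \<and>
     (\<forall>J. is_ideal J \<and> I \<subseteq> J \<longrightarrow> J = I \<or> J = UNIV)"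

definition poisson_ideal :: "cpoly3 \<Rightarrow> cpoly3 \<Rightarrow> cpoly3 set \<Rightarrow> bool" where
  "poisson_ideal s t I \<longleftrightarrow> is_ideal I \<and> (\<forall>a. \<forall>i\<in>I. pbr s t a i \<in> I)"

definition poisson_prime :: "cpoly3 \<Rightarrow> cpoly3 \<Rightarrow> cpoly3 set \<Rightarrow> bool" where
  "poisson_prime s t P \<longleftrightarrow> poisson_ideal s t P \<and> is_prime_ideal P"

definition poisson_maximal :: "cpoly3 \<Rightarrow> cpoly3 \<Rightarrow> cpoly3 set \<Rightarrow> bool" where
  "poisson_maximal s t M \<longleftrightarrow> is_maximal_ideal M \<and> poisson_ideal s t M"

definition is_poisson_core :: "cpoly3 \<Rightarrow> cpoly3 \<Rightarrow> cpoly3 set \<Rightarrow> cpoly3 set \<Rightarrow> bool" where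
  "is_poisson_core s t I P \<longleftrightarrow> poisson_ideal s t P \<and> P \<subseteq> I \<and>
     (\<forall>Q. poisson_ideal s t Q \<and> Q \<subseteq> I \<longrightarrow> Q \<subseteq> P)"

definition poisson_primitive :: "cpoly3 \<Rightarrow> cpoly3 \<Rightarrow> cpoly3 set \<Rightarrow> bool" where
  "poisson_primitive s t P \<longleftrightarrow> poisson_prime s t P \<and>
     (\<exists>M. is_maximal_ideal M \<and> is_poisson_core s t M P)"

definition locally_closed :: "cpoly3 \<Rightarrow> cpoly3 \<Rightarrow> cpoly3 set \<Rightarrow> bool" where
  "locally_closed s t P \<longleftrightarrow> poisson_prime s t P \<and>
     P \<noteq> \<Inter>{Q. poisson_prime s t Q \<and> P \<subset> Q}"

text \<open>Elements of Q(A/P) are fractions a/b with b \<notin> P, where a/b = c/d iff ad - bc \<in> P.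
  The induced bracket is
  {a/b, c/d} = ({a,c} b d - {a,d} b c - {b,c} a d + {b,d} a c) / (b^2 d^2),
  which is zero iff its numerator lies in P. The Poisson centre of Q(A/P)
  is C iff every Poisson-central fraction equals a scalar.\<close>
definition frac_bracket_num :: "cpoly3 \<Rightarrow> cpoly3 \<Rightarrow> cpoly3 \<Rightarrow> cpoly3 \<Rightarrow> cpoly3 \<Rightarrow> cpoly3 \<Rightarrow> cpoly3" where
  "frac_bracket_num s t a b c d =
     pbr s t a c * b * d - pbr s t a d * b * c - pbr s t b c * a * d + pbr s t b d * a * c"

definition frac_poisson_central :: "cpoly3 \<Rightarrow> cpoly3 \<Rightarrow> cpoly3 set \<Rightarrow> cpoly3 \<Rightarrow> cpoly3 \<Rightarrow> bool" where
  "frac_poisson_central s t P a b \<longleftrightarrow> b \<notin> P \<and>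
     (\<forall>c d. d \<notin> P \<longrightarrow> frac_bracket_num s t a b c d \<in> P)"

definition poisson_rational :: "cpoly3 \<Rightarrow> cpoly3 \<Rightarrow> cpoly3 set \<Rightarrow> bool" where
  "poisson_rational s t P \<longleftrightarrow> poisson_prime s t P \<and>
     (\<forall>a b. frac_poisson_central s t P a b \<longrightarrow> (\<exists>c. a - const3 c * b \<in> P))"

definition max_ideal_at :: "complex \<Rightarrow> complex \<Rightarrow> complex \<Rightarrow> cpoly3 set" where
  "max_ideal_at \<alpha> \<beta> \<gamma> = {a * (varX - const3 \<alpha>) + b * (varY - const3 \<beta>) + c * (varZ - const3 \<gamma>) | a b c. True}"

definition singular_point :: "cpoly3 \<Rightarrow> complex \<Rightarrow> complex \<Rightarrow> complex \<Rightarrow> bool" where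
  "singular_point f \<alpha> \<beta> \<gamma> \<longleftrightarrow> eval3 f \<alpha> \<beta> \<gamma> = 0 \<and> eval3 (dX f) \<alpha> \<beta> \<gamma> = 0 \<and>
     eval3 (dY f) \<alpha> \<beta> \<gamma> = 0 \<and> eval3 (dZ f) \<alpha> \<beta> \<gamma> = 0"

definition pencil :: "cpoly3 \<Rightarrow> cpoly3 \<Rightarrow> complex \<Rightarrow> complex \<Rightarrow> cpoly3" where
  "pencil s t la mu = const3 la * s - const3 mu * t"

definition principal_ideal :: "cpoly3 \<Rightarrow> cpoly3 set" where
  "principal_ideal u = {u * a | a. True}"

end

theory Submission
  imports Defs "HOL-Analysis.Continuum_Not_Denumerable"
begin

text \<open>
  The bracket is \<open>{f, g} = det (\<nabla>f, \<nabla>g, W)\<close> with \<open>W = t \<nabla>s - s \<nabla>t\<close>, whose components are the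
  \<^emph>\<open>Wronskians\<close> below. If a Poisson prime contains all components of \<open>W\<close>, the induced bracket is zero
  and everything reduces to the Nullstellensatz. Otherwise the prime has height at most one: two coprime
  elements would yield, after eliminating a variable, a nonzero polynomial in two variables, and bracketing
  with the coordinates differentiates it down to a constant, up to powers of a component \<open>w\<close> of \<open>W\<close>.
  The same descent, in the saturation at \<open>w\<close>, shows that such a height one prime \<open>uA\<close> is the Poisson core
  of every point of \<open>u = 0\<close> where \<open>w\<close> does not vanish. The member of the pencil through that point
  generates a Poisson ideal, so it is divisible by \<open>u\<close>, and only once since \<open>u\<^sup>2 dvd f\<close> would force
  \<open>u dvd w\<close>. A central fraction \<open>a/b\<close> of \<open>A/uA\<close> minus its value at such a point has a numerator
  generating, after saturation at \<open>b\<close>, a Poisson ideal inside the maximal ideal, hence inside \<open>uA\<close>.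
  Finally \<open>0\<close> is neither rational (\<open>s/t\<close> is central) nor primitive nor locally closed.
\<close>

section \<open>Partial derivatives and elimination\<close>

locale derivation =
  fixes D :: "'a::comm_ring_1 \<Rightarrow> 'a"
  assumes add: "D (a + b) = D a + D b"
    and mult: "D (a * b) = D a * b + a * D b"
begin

lemma zero: "D 0 = 0"
  using add[of 0 0] by simp

lemma minus: "D (- a) = - D a"
  using add[of a "- a"] zero by (simp add: add_eq_0_iff)

lemma diff: "D (a - b) = D a - D b"
  using add[of a "- b"] minus[of b] by simp

lemma sum: "D (sum f A) = (\<Sum>i\<in>A. D (f i))"
  by (induction A rule: infinite_finite_induct) (simp_all add: zero add)

end

lemma derivation_pderiv: "derivation (pderiv :: 'a::idom poly \<Rightarrow> 'a poly)"
  by unfold_locales (simp_all add: pderiv_add pderiv_mult)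

lemma derivation_map_poly:
  assumes "derivation D"
  shows "derivation (map_poly D)"
proof -
  interpret derivation D by fact
  show ?thesis
    by unfold_locales
      (simp_all add: poly_eq_iff coeff_map_poly zero add coeff_mult sum mult sum.distrib)
qed

lemma derivation_dX: "derivation dX"
  and derivation_dY: "derivation dY"
  and derivation_dZ: "derivation dZ"
proof -
  have "dX = map_poly (map_poly pderiv)" "dY = map_poly pderiv" "dZ = pderiv"
    by (simp_all add: fun_eq_iff dX_def dY_def dZ_def)
  then show "derivation dX" "derivation dY" "derivation dZ"
    using derivation_pderiv derivation_map_poly by metis+
qed

interpretation dX: derivation dX by (rule derivation_dX)
interpretation dY: derivation dY by (rule derivation_dY)
interpretation dZ: derivation dZ by (rule derivation_dZ)

lemma d_var [simp]:
  "dX varX = 1" "dX varY = 0" "dX varZ = 0"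
  "dY varX = 0" "dY varY = 1" "dY varZ = 0"
  "dZ varX = 0" "dZ varY = 0" "dZ varZ = 1"
  by (simp_all add: dX_def dY_def dZ_def varX_def varY_def varZ_def pderiv_pCons map_poly_pCons one_pCons)

lemma d_const [simp]: "dX (const3 c) = 0" "dY (const3 c) = 0" "dZ (const3 c) = 0"
  by (simp_all add: dX_def dY_def dZ_def const3_def pderiv_pCons map_poly_pCons)

lemma coeff_d:
  "coeff (coeff (coeff (dX f) i) j) k = of_nat (Suc k) * coeff (coeff (coeff f i) j) (Suc k)"
  "coeff (coeff (coeff (dY f) i) j) k = of_nat (Suc j) * coeff (coeff (coeff f i) (Suc j)) k"
  "coeff (coeff (coeff (dZ f) i) j) k = of_nat (Suc i) * coeff (coeff (coeff f (Suc i)) j) k"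
  by (simp_all add: dX_def dY_def dZ_def coeff_map_poly coeff_pderiv of_nat_poly del: of_nat_Suc)

lemma poly3_eqI:
  "(\<And>i j k. coeff (coeff (coeff f i) j) k = coeff (coeff (coeff g i) j) k) \<Longrightarrow> f = (g :: cpoly3)"
  by (simp add: poly_eq_iff)

lemma d_commute: "dX (dY f) = dY (dX f)" "dX (dZ f) = dZ (dX f)" "dY (dZ f) = dZ (dY f)"
  by (intro poly3_eqI, simp add: coeff_d)+

lemma const3_simps:
  "const3 (a + b) = const3 a + const3 b" "const3 (a * b) = const3 a * const3 b"
  "const3 (- a) = - const3 a" "const3 (a - b) = const3 a - const3 b"
  "const3 0 = 0" "const3 1 = 1"
  by (simp_all add: const3_def flip: one_pCons)

lemma const3_eq_0_iff [simp]: "const3 c = 0 \<longleftrightarrow> c = 0"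
  by (simp add: const3_def)

lemma is_unit_const3: "c \<noteq> 0 \<Longrightarrow> is_unit (const3 c)"
  by (intro dvdI[where k = "const3 (inverse c)"]) (simp add: const3_simps flip: const3_simps(2))

lemma is_unit_imp_const3: "is_unit f \<Longrightarrow> \<exists>c. c \<noteq> 0 \<and> f = const3 c"
  by (auto simp: is_unit_poly_iff const3_def)

lemma const3_if_derivatives_zero:
  assumes "dX f = 0" "dY f = 0" "dZ f = 0"
  shows "\<exists>c. f = const3 c"
proof -
  have "degree f = 0" using assms(3) by (simp add: dZ_def pderiv_eq_0_iff)
  then obtain g where g: "f = [:g:]" by (auto elim: degree_eq_zeroE)
  have "degree g = 0" using assms(2) by (simp add: g dY_def map_poly_pCons pderiv_eq_0_iff)
  then obtain h where h: "g = [:h:]" by (auto elim: degree_eq_zeroE)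
  have "degree h = 0" using assms(1) by (simp add: g h dX_def map_poly_pCons pderiv_eq_0_iff)
  then obtain c where "h = [:c:]" by (auto elim: degree_eq_zeroE)
  then show ?thesis by (auto simp: g h const3_def)
qed

section \<open>Permuting the variables\<close>

text \<open>The ring automorphism exchanging the inner and the outer variable; on the array of
  coefficients it is transposition.\<close>

definition swap_vars :: "'a::comm_ring_1 poly poly \<Rightarrow> 'a poly poly" where
  "swap_vars f = (\<Sum>i\<le>degree f. map_poly (\<lambda>c. monom c i) (coeff f i))"

lemma coeff_swap_vars: "coeff (coeff (swap_vars f) i) j = coeff (coeff f j) i"
proof -
  have "coeff (coeff (swap_vars f) i) j = (\<Sum>k\<le>degree f. if k = j then coeff (coeff f k) i else 0)"
    unfolding swap_vars_def coeff_sum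
    by (intro sum.cong) (simp_all add: coeff_map_poly)
  also have "\<dots> = coeff (coeff f j) i"
    by (auto simp: coeff_eq_0)
  finally show ?thesis .
qed

lemma swap_vars_involution: "swap_vars (swap_vars f) = f"
  by (simp add: poly_eq_iff coeff_swap_vars)

lemma swap_vars_add: "swap_vars (f + g) = swap_vars f + swap_vars g"
  by (simp add: poly_eq_iff coeff_swap_vars)

lemma swap_vars_mult: "swap_vars (f * g) = swap_vars f * swap_vars g"
proof (intro poly_eqI)
  fix i j
  show "coeff (coeff (swap_vars (f * g)) i) j = coeff (coeff (swap_vars f * swap_vars g) i) j"
    unfolding coeff_swap_vars coeff_mult coeff_sum by (rule sum.swap)
qed

lemma swap_vars_0: "swap_vars 0 = 0"
  by (simp add: poly_eq_iff coeff_swap_vars)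

text \<open>Degree arguments are direct for the outermost variable. A ring automorphism that carries
  \<open>D\<close> to \<open>dZ\<close> extends them to the other two partial derivatives.\<close>

locale dZ_conjugate =
  fixes D :: "cpoly3 \<Rightarrow> cpoly3" and \<phi> \<psi> :: "cpoly3 \<Rightarrow> cpoly3"
  assumes inv: "\<psi> (\<phi> f) = f" "\<phi> (\<psi> f) = f"
    and add: "\<phi> (f + g) = \<phi> f + \<phi> g"
    and mult: "\<phi> (f * g) = \<phi> f * \<phi> g"
    and conj: "\<phi> (D f) = dZ (\<phi> f)"

lemma dZ_conjugate_exists:
  assumes "D \<in> {dX, dY, dZ}"
  shows "\<exists>\<phi> \<psi>. dZ_conjugate D \<phi> \<psi>"
proof -
  have Z: "dZ_conjugate dZ (\<lambda>f. f) (\<lambda>f. f)"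
    by unfold_locales simp_all
  have Y: "dZ_conjugate dY swap_vars swap_vars"
    by unfold_locales
      (simp_all add: swap_vars_involution swap_vars_add swap_vars_mult,
       intro poly3_eqI, simp add: coeff_swap_vars coeff_d)
  \<comment> \<open>The inner swap lifts x to the middle position, the outer swap takes it from
    there to the outermost one.\<close>
  have X: "dZ_conjugate dX (\<lambda>f. swap_vars (map_poly swap_vars f))
      (\<lambda>f. map_poly swap_vars (swap_vars f))"
  proof unfold_locales
    fix f g
    have *: "map_poly swap_vars (f * g) = map_poly swap_vars f * map_poly swap_vars (g :: cpoly3)"
    proof (intro poly_eqI)
      fix n i j
      have "swap_vars (sum F A) = (\<Sum>k\<in>A. swap_vars (F k))" for F :: "nat \<Rightarrow> complex poly poly" and A
        by (induction A rule: infinite_finite_induct) (simp_all add: swap_vars_0 swap_vars_add)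
      then show "coeff (coeff (coeff (map_poly swap_vars (f * g)) n) i) j
          = coeff (coeff (coeff (map_poly swap_vars f * map_poly swap_vars g) n) i) j"
        by (simp add: coeff_map_poly swap_vars_0 coeff_mult[of f g]
            coeff_mult[of "map_poly swap_vars f"] swap_vars_mult)
    qed
    show "swap_vars (map_poly swap_vars (f * g))
        = swap_vars (map_poly swap_vars f) * swap_vars (map_poly swap_vars g)"
      by (simp add: * swap_vars_mult)
  next
    fix f
    show "swap_vars (map_poly swap_vars (dX f)) = dZ (swap_vars (map_poly swap_vars f))"
      by (intro poly3_eqI) (simp add: coeff_swap_vars coeff_map_poly coeff_d swap_vars_0)
  qed (intro poly3_eqI, simp add: coeff_swap_vars coeff_map_poly swap_vars_0)+
  show ?thesis using assms X Y Z by blast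
qed

context dZ_conjugate
begin

lemma map_zero: "\<phi> 0 = 0"
  using add[of 0 0] by simp

lemma map_eq_0_iff: "\<phi> f = 0 \<longleftrightarrow> f = 0"
  using inv map_zero by metis

lemma map_dvd_iff: "\<phi> f dvd \<phi> g \<longleftrightarrow> f dvd g"
  by (metis dvd_def inv mult)

lemma map_coprime:
  assumes "coprime f g"
  shows "coprime (\<phi> f) (\<phi> g)"
proof (rule coprimeI)
  fix c assume "c dvd \<phi> f" "c dvd \<phi> g"
  then have "\<psi> c dvd f" "\<psi> c dvd g" by (metis inv(2) map_dvd_iff)+
  then have "is_unit (\<psi> c)" by (rule coprime_common_divisor[OF assms])
  then have "\<psi> c dvd \<psi> 1" by (meson dvd_trans one_dvd)
  then have "c dvd 1" by (metis inv(2) map_dvd_iff)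
  then show "is_unit c" .
qed

end

text \<open>Each differentiation lowers the degree in its variable until nothing is left. This makes
  the later descent by differentiation stop.\<close>

lemma derivative_nilpotent:
  assumes "D \<in> {dX, dY, dZ}"
  shows "\<exists>n. (D ^^ n) f = 0"
proof -
  obtain \<phi> \<psi> where "dZ_conjugate D \<phi> \<psi>" using dZ_conjugate_exists[OF assms] by blast
  then interpret dZ_conjugate D \<phi> \<psi> .
  have "\<phi> ((D ^^ n) f) = (pderiv ^^ n) (\<phi> f)" for n
    by (induction n) (simp_all add: conj dZ_def)
  moreover have "\<exists>n. (pderiv ^^ n) g = 0" for g :: cpoly3
  proof (induction "degree g" arbitrary: g rule: less_induct)
    case less
    show ?case
    proof (cases "degree g = 0")
      case True
      then have "(pderiv ^^ 1) g = 0" by (simp add: pderiv_eq_0_iff)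
      then show ?thesis by blast
    next
      case False
      then have "degree (pderiv g) < degree g" by (simp add: degree_pderiv)
      from less[OF this] obtain n where "(pderiv ^^ Suc n) g = 0"
        by (auto simp: funpow_Suc_right simp del: funpow.simps)
      then show ?thesis by blast
    qed
  qed
  ultimately show ?thesis using map_eq_0_iff by metis
qed

text \<open>A nonzero multiple of \<open>u\<close> has at least the degree of \<open>u\<close> in
  the variable of \<open>D\<close>, whereas differentiation lowers a positive degree.\<close>

lemma dvd_derivative_imp_zero:
  assumes "D \<in> {dX, dY, dZ}" "u dvd D u"
  shows "D u = 0"
proof -
  obtain \<phi> \<psi> where "dZ_conjugate D \<phi> \<psi>" using dZ_conjugate_exists[OF assms(1)] by blast
  then interpret dZ_conjugate D \<phi> \<psi> .
  have "\<phi> u dvd pderiv (\<phi> u)" using assms(2) map_dvd_iff conj by (metis dZ_def)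
  then have "pderiv (\<phi> u) = 0"
    by (metis degree_pderiv diff_less dvd_imp_degree_le gr0I leD pderiv_eq_0_iff zero_less_one)
  then show ?thesis by (metis conj dZ_def map_eq_0_iff)
qed

section \<open>Eliminating a variable between coprime polynomials\<close>

text \<open>Take a nonzero element of least degree in the ideal generated by \<open>u\<close> and
  \<open>g\<close>. By pseudo-division it divides both generators up to nonzero constants of the
  coefficient ring. If its degree were positive, a prime factor of positive degree would divide
  both, against coprimality.\<close>

lemma eliminate_outer_variable:
  fixes u g :: "'a::{factorial_ring_gcd, semiring_gcd_mult_normalize} poly"
  assumes "coprime u g" "u \<noteq> 0"
  shows "\<exists>a b. a * u + b * g \<noteq> 0 \<and> degree (a * u + b * g) = 0"
proof -
  define S where "S = {h. h \<noteq> 0 \<and> (\<exists>a b. h = a * u + b * g)}"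
  have "u = 1 * u + 0 * g" by simp
  then have "u \<in> S" unfolding S_def using assms(2) by blast
  then obtain h where hS: "h \<in> S" and min: "\<And>k. k \<in> S \<Longrightarrow> degree h \<le> degree k"
    using ex_has_least_nat[of "\<lambda>k. k \<in> S" u degree] by blast
  have h: "h \<noteq> 0" using hS by (simp add: S_def)
  have divides: "\<exists>c. c \<noteq> 0 \<and> h dvd smult c f" if f: "f \<in> {u, g}" for f
  proof -
    obtain c q where c: "c \<noteq> 0" "smult c f = h * q + pseudo_mod f h"
      and r: "pseudo_mod f h = 0 \<or> degree (pseudo_mod f h) < degree h"
      using pseudo_mod(1)[OF h] pseudo_mod(2)[OF h] by blast
    obtain a b where ab: "h = a * u + b * g" using hS by (auto simp: S_def)
    have "pseudo_mod f h = [:c:] * f - h * q" using c by simp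
    also have "\<exists>a' b'. \<dots> = a' * u + b' * g"
    proof (cases "f = u")
      case True
      then have "[:c:] * f - h * q = ([:c:] - a * q) * u + (- (b * q)) * g"
        by (simp add: ab algebra_simps)
      then show ?thesis by blast
    next
      case False
      then have "[:c:] * f - h * q = (- (a * q)) * u + ([:c:] - b * q) * g"
        using f by (simp add: ab algebra_simps)
      then show ?thesis by blast
    qed
    finally have "pseudo_mod f h \<in> S \<or> pseudo_mod f h = 0" by (auto simp: S_def)
    then have "pseudo_mod f h = 0" using r min by fastforce
    then show ?thesis using c by auto
  qed
  have "degree h = 0"
  proof (rule ccontr)
    assume deg: "degree h \<noteq> 0"
    have "\<exists>p. p \<in># prime_factorization h \<and> degree p \<noteq> 0"
    proof (rule ccontr)
      assume "\<not> ?thesis"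
      then have *: "\<And>p. p \<in># prime_factorization h \<Longrightarrow> degree p = 0" by blast
      have "degree (prod_mset M) = 0" if "\<And>p. p \<in># M \<Longrightarrow> degree p = 0" for M :: "'a poly multiset"
        using that
      proof (induction M)
        case (add p M)
        then show ?case using degree_mult_le[of p "prod_mset M"] by simp
      qed simp
      then have "degree (prod_mset (prime_factorization h)) = 0" using * by blast
      moreover have "normalize (prod_mset (prime_factorization h)) = normalize h"
        using h by (rule prod_mset_prime_factorization_weak)
      then have "h dvd prod_mset (prime_factorization h)" "prod_mset (prime_factorization h) \<noteq> 0"
        using h by (metis associatedD2, metis normalize_eq_0_iff)
      then have "degree h \<le> degree (prod_mset (prime_factorization h))"
        by (rule dvd_imp_degree_le)
      ultimately show False using deg by simp
    qed
    then obtain p where p: "p \<in># prime_factorization h" "degree p \<noteq> 0" by blast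
    then have "prime p" "p dvd h" by auto
    have "p dvd f" if f: "f \<in> {u, g}" for f
    proof -
      obtain c where c: "c \<noteq> 0" "h dvd smult c f" using divides[OF f] by blast
      then have "p dvd [:c:] * f" using \<open>p dvd h\<close> dvd_trans by auto
      \<comment> \<open>The factor \<open>c\<close> lost in pseudo-division has degree zero, so a
        prime of positive degree must divide \<open>f\<close> instead.\<close>
      moreover have "\<not> p dvd [:c:]"
        using p(2) c(1) by (metis degree_pCons_0 dvd_imp_degree_le le_zero_eq pCons_eq_0_iff)
      ultimately show ?thesis using \<open>prime p\<close> by (metis prime_dvd_multD)
    qed
    then have "is_unit p" using assms(1) by (blast intro: coprime_common_divisor)
    then show False using \<open>prime p\<close> by (meson not_prime_unit)
  qed
  then show ?thesis using hS h by (auto simp: S_def)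
qed

text \<open>Being killed by \<open>D\<close> means being free of its variable, so the outermost case
  carries over along the automorphism.\<close>

lemma eliminate_variable:
  assumes "D \<in> {dX, dY, dZ}" "coprime u g" "u \<noteq> 0"
  shows "\<exists>a b. a * u + b * g \<noteq> 0 \<and> D (a * u + b * g) = 0"
proof -
  obtain \<phi> \<psi> where "dZ_conjugate D \<phi> \<psi>" using dZ_conjugate_exists[OF assms(1)] by blast
  then interpret dZ_conjugate D \<phi> \<psi> .
  obtain a b where ab: "a * \<phi> u + b * \<phi> g \<noteq> 0" "degree (a * \<phi> u + b * \<phi> g) = 0"
    using eliminate_outer_variable[OF map_coprime[OF assms(2)]] assms(3) map_eq_0_iff by metis
  have eq: "\<phi> (\<psi> a * u + \<psi> b * g) = a * \<phi> u + b * \<phi> g" by (simp add: add mult inv)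
  then have "\<phi> (D (\<psi> a * u + \<psi> b * g)) = 0"
    using ab(2) by (simp add: conj dZ_def pderiv_eq_0_iff)
  then show ?thesis using ab(1) eq map_eq_0_iff by metis
qed

section \<open>Ideals and the Nullstellensatz\<close>

lemma ideal_zero: "is_ideal I \<Longrightarrow> 0 \<in> I"
  and ideal_add: "is_ideal I \<Longrightarrow> a \<in> I \<Longrightarrow> b \<in> I \<Longrightarrow> a + b \<in> I"
  and ideal_mult: "is_ideal I \<Longrightarrow> a \<in> I \<Longrightarrow> r * a \<in> I"
  and ideal_mult_right: "is_ideal I \<Longrightarrow> a \<in> I \<Longrightarrow> a * r \<in> I"
  by (auto simp: is_ideal_def mult.commute[of a r])

lemma ideal_minus: "is_ideal I \<Longrightarrow> a \<in> I \<Longrightarrow> - a \<in> I"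
  using ideal_mult[of I a "- 1"] by simp

lemma ideal_diff: "is_ideal I \<Longrightarrow> a \<in> I \<Longrightarrow> b \<in> I \<Longrightarrow> a - b \<in> I"
  using ideal_add[of I a "- b"] ideal_minus[of I b] by simp

lemmas ideal_closed = ideal_zero ideal_add ideal_minus ideal_diff ideal_mult ideal_mult_right

lemma ideal_sum: "is_ideal I \<Longrightarrow> (\<And>i. i \<in> A \<Longrightarrow> f i \<in> I) \<Longrightarrow> sum f A \<in> I"
  by (induction A rule: infinite_finite_induct) (auto intro: ideal_closed)

lemma ideal_eq_UNIV_iff: "is_ideal I \<Longrightarrow> I = UNIV \<longleftrightarrow> 1 \<in> I"
  using ideal_mult[of I 1] by auto

lemma prime_idealD:
  assumes "is_prime_ideal P"
  shows "is_ideal P" "1 \<notin> P" "a * b \<in> P \<Longrightarrow> a \<in> P \<or> b \<in> P"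
  using assms ideal_eq_UNIV_iff by (auto simp only: is_prime_ideal_def)

lemma prime_ideal_power: "is_prime_ideal P \<Longrightarrow> a ^ n \<in> P \<Longrightarrow> a \<in> P"
  by (induction n) (auto dest: prime_idealD)

lemma is_unit_in_ideal: "is_ideal I \<Longrightarrow> u \<in> I \<Longrightarrow> is_unit u \<Longrightarrow> I = UNIV"
  using ideal_eq_UNIV_iff ideal_mult_right by (metis dvdE)

section \<open>Evaluation and the maximal ideals of points\<close>

lemma eval3_simps [simp]:
  "eval3 (f + g) \<alpha> \<beta> \<gamma> = eval3 f \<alpha> \<beta> \<gamma> + eval3 g \<alpha> \<beta> \<gamma>"
  "eval3 (f - g) \<alpha> \<beta> \<gamma> = eval3 f \<alpha> \<beta> \<gamma> - eval3 g \<alpha> \<beta> \<gamma>"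
  "eval3 (f * g) \<alpha> \<beta> \<gamma> = eval3 f \<alpha> \<beta> \<gamma> * eval3 g \<alpha> \<beta> \<gamma>"
  "eval3 (const3 c) \<alpha> \<beta> \<gamma> = c"
  "eval3 0 \<alpha> \<beta> \<gamma> = 0" "eval3 1 \<alpha> \<beta> \<gamma> = 1"
  "eval3 varX \<alpha> \<beta> \<gamma> = \<alpha>" "eval3 varY \<alpha> \<beta> \<gamma> = \<beta>" "eval3 varZ \<alpha> \<beta> \<gamma> = \<gamma>"
  by (simp_all add: eval3_def const3_def varX_def varY_def varZ_def)

lemma cong_poly_eval:
  fixes f :: "'a::idom poly"
  shows "\<exists>q. f = [:poly f c:] + q * [:- c, 1:]"
proof -
  have "[:- c, 1:] dvd f - [:poly f c:]" by (simp flip: poly_eq_0_iff_dvd)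
  then obtain q where "f - [:poly f c:] = [:- c, 1:] * q" by (elim dvdE)
  then have "f = [:poly f c:] + q * [:- c, 1:]" by (simp add: algebra_simps)
  then show ?thesis by blast
qed

text \<open>Division by a monic linear polynomial in z, then of the remainder in y, then in x,
  leaves the value at the point.\<close>

lemma expand_at_point:
  "\<exists>a b c. f = const3 (eval3 f \<alpha> \<beta> \<gamma>) + (a * (varX - const3 \<alpha>) + b * (varY - const3 \<beta>) + c * (varZ - const3 \<gamma>))"
proof -
  define g where "g = poly f [:[:\<gamma>:]:]"
  define h where "h = poly g [:\<beta>:]"
  obtain q1 where q1: "f = [:g:] + q1 * [:- [:[:\<gamma>:]:], 1:]"
    using cong_poly_eval g_def by metis
  obtain q2 where q2: "g = [:h:] + q2 * [:- [:\<beta>:], 1:]"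
    using cong_poly_eval h_def by metis
  obtain q3 where q3: "h = [:poly h \<alpha>:] + q3 * [:- \<alpha>, 1:]"
    using cong_poly_eval by metis
  have v: "varX - const3 \<alpha> = [:[:[:- \<alpha>, 1:]:]:]" "varY - const3 \<beta> = [:[:- [:\<beta>:], 1:]:]"
    "varZ - const3 \<gamma> = [:- [:[:\<gamma>:]:], 1:]"
    by (simp_all add: varX_def varY_def varZ_def const3_def)
  have "eval3 f \<alpha> \<beta> \<gamma> = poly h \<alpha>" by (simp add: eval3_def g_def h_def)
  moreover have "[:[:h:]:] = const3 (poly h \<alpha>) + [:[:q3:]:] * [:[:[:- \<alpha>, 1:]:]:]"
    by (subst q3) (simp add: const3_def)
  moreover have "[:g:] = [:[:h:]:] + [:q2:] * [:[:- [:\<beta>:], 1:]:]"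
    by (subst q2) simp
  ultimately have "f = const3 (eval3 f \<alpha> \<beta> \<gamma>) + ([:[:q3:]:] * (varX - const3 \<alpha>)
      + [:q2:] * (varY - const3 \<beta>) + q1 * (varZ - const3 \<gamma>))"
    unfolding v by (subst q1) (simp only: add.assoc)
  then show ?thesis by blast
qed

lemma max_ideal_at_eq: "max_ideal_at \<alpha> \<beta> \<gamma> = {f. eval3 f \<alpha> \<beta> \<gamma> = 0}"
proof (intro equalityI subsetI)
  fix f assume "f \<in> max_ideal_at \<alpha> \<beta> \<gamma>"
  then show "f \<in> {f. eval3 f \<alpha> \<beta> \<gamma> = 0}" by (auto simp: max_ideal_at_def)
next
  fix f assume "f \<in> {f. eval3 f \<alpha> \<beta> \<gamma> = 0}"
  then show "f \<in> max_ideal_at \<alpha> \<beta> \<gamma>"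
    using expand_at_point[of f \<alpha> \<beta> \<gamma>] by (auto simp: max_ideal_at_def const3_simps)
qed

lemma max_ideal_at_subset_ideal:
  assumes "is_ideal I" "varX - const3 \<alpha> \<in> I" "varY - const3 \<beta> \<in> I" "varZ - const3 \<gamma> \<in> I"
  shows "max_ideal_at \<alpha> \<beta> \<gamma> \<subseteq> I"
  using assms by (auto simp: max_ideal_at_def intro!: ideal_add ideal_mult)

lemma is_ideal_max_ideal_at: "is_ideal (max_ideal_at \<alpha> \<beta> \<gamma>)"
  by (auto simp: is_ideal_def max_ideal_at_eq)

lemma is_prime_ideal_max_ideal_at: "is_prime_ideal (max_ideal_at \<alpha> \<beta> \<gamma>)"
  using is_ideal_max_ideal_at[of \<alpha> \<beta> \<gamma>]
  by (auto simp: is_prime_ideal_def ideal_eq_UNIV_iff) (auto simp: max_ideal_at_eq)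

text \<open>Modulo the ideal of a point every polynomial equals its value there, and a nonzero value
  is a unit.\<close>

lemma is_maximal_ideal_max_ideal_at: "is_maximal_ideal (max_ideal_at \<alpha> \<beta> \<gamma>)"
  unfolding is_maximal_ideal_def
proof (intro conjI allI impI)
  show "is_ideal (max_ideal_at \<alpha> \<beta> \<gamma>)" by (rule is_ideal_max_ideal_at)
  show "max_ideal_at \<alpha> \<beta> \<gamma> \<noteq> UNIV"
    using is_prime_ideal_max_ideal_at by (simp add: is_prime_ideal_def)
  fix J assume J: "is_ideal J \<and> max_ideal_at \<alpha> \<beta> \<gamma> \<subseteq> J"
  show "J = max_ideal_at \<alpha> \<beta> \<gamma> \<or> J = UNIV"
  proof (rule disjCI)
    assume "J \<noteq> UNIV"
    have "f \<in> max_ideal_at \<alpha> \<beta> \<gamma>" if "f \<in> J" for f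
    proof (rule ccontr)
      assume f: "f \<notin> max_ideal_at \<alpha> \<beta> \<gamma>"
      have "f - const3 (eval3 f \<alpha> \<beta> \<gamma>) \<in> max_ideal_at \<alpha> \<beta> \<gamma>" by (simp add: max_ideal_at_eq)
      then have "f - (f - const3 (eval3 f \<alpha> \<beta> \<gamma>)) \<in> J" using J that by (blast intro: ideal_diff)
      then have "const3 (eval3 f \<alpha> \<beta> \<gamma>) \<in> J" by simp
      moreover have "is_unit (const3 (eval3 f \<alpha> \<beta> \<gamma>))"
        using f by (intro is_unit_const3) (simp add: max_ideal_at_eq)
      ultimately show False using J \<open>J \<noteq> UNIV\<close> is_unit_in_ideal by blast
    qed
    then show "J = max_ideal_at \<alpha> \<beta> \<gamma>" using J by blast
  qed
qed

section \<open>The Nullstellensatz by a countability argument\<close>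

text \<open>Gaussian elimination with unknowns indexed by \<open>S\<close> and equations by
  \<open>I\<close>: each equation is spent on removing one pivot unknown, and at least one unknown
  remains free.\<close>

lemma homogeneous_system_nontrivial_solution:
  fixes v :: "'s \<Rightarrow> 'i \<Rightarrow> 'k::field"
  assumes "finite I" "finite S" "card I < card S"
  shows "\<exists>l. (\<exists>c\<in>S. l c \<noteq> 0) \<and> (\<forall>i\<in>I. (\<Sum>c\<in>S. l c * v c i) = 0)"
  using assms
proof (induction I arbitrary: S v rule: finite_induct)
  case empty
  then obtain c where "c \<in> S" by (metis card.empty card_gt_0_iff ex_in_conv)
  then show ?case by (auto intro!: exI[where x = "\<lambda>_. 1"])
next
  case (insert i I)
  show ?case
  proof (cases "\<exists>e\<in>S. v e i \<noteq> 0")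
    case False
    then show ?thesis using insert by auto
  next
    case True
    then obtain e where e: "e \<in> S" "v e i \<noteq> 0" by blast
    define S' where "S' = S - {e}"
    \<comment> \<open>Multiples of the pivot column \<open>e\<close> are subtracted so that row
      \<open>i\<close> becomes zero.\<close>
    define v' where "v' c j = v c j - v c i / v e i * v e j" for c j
    have S: "S = insert e S'" "e \<notin> S'" "finite S'" using e insert.prems by (auto simp: S'_def)
    have "card I < card S'" using insert.hyps insert.prems S by simp
    from insert.IH[OF S(3) this, of v'] obtain l where l: "\<exists>c\<in>S'. l c \<noteq> 0"
      "\<And>j. j \<in> I \<Longrightarrow> (\<Sum>c\<in>S'. l c * v' c j) = 0" by blast
    \<comment> \<open>The value at the pivot \<open>e\<close> is the one that compensates these
      column operations.\<close>
    define m where "m = l(e := - (\<Sum>c\<in>S'. l c * (v c i / v e i)))"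
    have eq: "(\<Sum>c\<in>S. m c * v c j) = (\<Sum>c\<in>S'. l c * v' c j)" for j
    proof -
      have "(\<Sum>c\<in>S'. m c * v c j) = (\<Sum>c\<in>S'. l c * v c j)"
        using S by (intro sum.cong) (auto simp: m_def)
      then have "(\<Sum>c\<in>S. m c * v c j)
          = (\<Sum>c\<in>S'. l c * v c j) - (\<Sum>c\<in>S'. l c * (v c i / v e i)) * v e j"
        using S by (simp add: m_def)
      also have "\<dots> = (\<Sum>c\<in>S'. l c * v' c j)"
        by (simp add: v'_def sum_distrib_right sum_subtractf right_diff_distrib mult.assoc)
      finally show ?thesis .
    qed
    have "v' c i = 0" for c using e by (simp add: v'_def)
    then have "\<forall>j\<in>insert i I. (\<Sum>c\<in>S. m c * v c j) = 0" using l(2) by (simp add: eq)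
    moreover have "\<exists>c\<in>S. m c \<noteq> 0" using l(1) S by (auto simp: m_def)
    ultimately show ?thesis by blast
  qed
qed

definition eval_at :: "complex poly \<Rightarrow> cpoly3 \<Rightarrow> cpoly3" where
  "eval_at q \<xi> = poly (map_poly const3 q) \<xi>"

lemma eval_at_add: "eval_at (p + q) \<xi> = eval_at p \<xi> + eval_at q \<xi>"
proof -
  have "map_poly const3 (p + q) = map_poly const3 p + map_poly const3 q"
    by (intro poly_eqI) (simp add: coeff_map_poly const3_simps)
  then show ?thesis by (simp add: eval_at_def)
qed

lemma eval_at_pCons: "eval_at (pCons a p) \<xi> = const3 a + \<xi> * eval_at p \<xi>"
  by (cases "pCons a p = 0") (auto simp: eval_at_def map_poly_pCons const3_simps)

lemma eval_at_0: "eval_at 0 \<xi> = 0"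
  by (simp add: eval_at_def)

lemma eval_at_smult: "eval_at (smult c p) \<xi> = const3 c * eval_at p \<xi>"
  by (induction p) (simp_all add: eval_at_0 eval_at_pCons const3_simps algebra_simps)

lemma eval_at_mult: "eval_at (p * q) \<xi> = eval_at p \<xi> * eval_at q \<xi>"
  by (induction p)
    (simp_all add: eval_at_0 eval_at_pCons eval_at_add eval_at_smult const3_simps algebra_simps)

lemma eval_at_1: "eval_at 1 \<xi> = 1"
  by (simp add: one_pCons eval_at_pCons eval_at_0 const3_simps)

lemma eval_at_linear: "eval_at [:- c, 1:] \<xi> = \<xi> - const3 c"
  by (simp add: eval_at_pCons eval_at_0 const3_simps)

lemma eval_at_sum: "eval_at (sum f A) \<xi> = (\<Sum>i\<in>A. eval_at (f i) \<xi>)"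
  by (induction A rule: infinite_finite_induct) (simp_all add: eval_at_0 eval_at_add)

lemma eval_at_prod: "eval_at (prod f A) \<xi> = (\<Prod>i\<in>A. eval_at (f i) \<xi>)"
  by (induction A rule: infinite_finite_induct) (simp_all add: eval_at_1 eval_at_mult)

text \<open>Over the complex numbers \<open>q\<close> splits into linear factors, and a prime ideal
  containing their product contains one of them.\<close>

lemma prime_ideal_linear_factor:
  assumes "is_prime_ideal N" "q \<noteq> 0" "eval_at q \<xi> \<in> N"
  shows "\<exists>c. \<xi> - const3 c \<in> N"
  using assms(2,3)
proof (induction "degree q" arbitrary: q rule: less_induct)
  case less
  show ?case
  proof (cases "degree q = 0")
    case True
    then obtain a where a: "q = [:a:]" by (auto elim: degree_eq_zeroE)
    then have "is_unit (eval_at q \<xi>)"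
      using less.prems by (simp add: eval_at_pCons eval_at_0 is_unit_const3)
    then show ?thesis
      using less.prems assms(1) is_unit_in_ideal by (auto simp: is_prime_ideal_def)
  next
    case False
    then obtain c where "poly q c = 0"
      using fundamental_theorem_of_algebra constant_degree by metis
    then obtain r where r: "q = [:- c, 1:] * r" using poly_eq_0_iff_dvd by (metis dvdE)
    have "r \<noteq> 0" using less.prems r by auto
    then have "degree q = 1 + degree r" unfolding r by (subst degree_mult_eq) auto
    moreover have "\<xi> - const3 c \<in> N \<or> eval_at r \<xi> \<in> N"
      using less.prems(2) prime_idealD(3)[OF assms(1)] by (metis eval_at_linear eval_at_mult r)
    ultimately show ?thesis using less.hyps \<open>r \<noteq> 0\<close> by auto
  qed
qed

text \<open>One bound for all three exponents exhausts A by countably many finite-dimensional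
  spaces, as the counting argument below requires.\<close>

lemma cpoly3_bounded: "\<exists>n. \<forall>i j k. coeff (coeff (coeff (g :: cpoly3) i) j) k \<noteq> 0 \<longrightarrow> i < n \<and> j < n \<and> k < n"
proof -
  \<comment> \<open>The function \<open>B\<close> lets the same bound also cover a quantity attached
    to each coefficient, so that the bounds can be nested.\<close>
  have fin: "\<exists>n. \<forall>i. coeff p i \<noteq> 0 \<longrightarrow> B i \<le> n \<and> i < n" for p :: "'b::zero poly" and B :: "nat \<Rightarrow> nat"
  proof (intro exI allI impI)
    fix i assume "coeff p i \<noteq> 0"
    then have "i \<le> degree p" by (rule le_degree)
    then have "B i \<le> (\<Sum>i\<le>degree p. B i)" by (intro member_le_sum) auto
    then show "B i \<le> Suc (degree p + (\<Sum>i\<le>degree p. B i)) \<and> i < Suc (degree p + (\<Sum>i\<le>degree p. B i))"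
      using \<open>i \<le> degree p\<close> by linarith
  qed
  have two: "\<exists>n. \<forall>j k. coeff (coeff h j) k \<noteq> 0 \<longrightarrow> j < n \<and> k < n" for h :: "complex poly poly"
  proof -
    obtain n where n: "\<And>j. coeff h j \<noteq> 0 \<Longrightarrow> Suc (degree (coeff h j)) \<le> n \<and> j < n"
      using fin[of h "\<lambda>j. Suc (degree (coeff h j))"] by blast
    have "j < n \<and> k < n" if "coeff (coeff h j) k \<noteq> 0" for j k
    proof -
      have "coeff h j \<noteq> 0" using that by auto
      then show ?thesis using n[of j] le_degree[OF that] by linarith
    qed
    then show ?thesis by blast
  qed
  then have "\<forall>i. \<exists>n. \<forall>j k. coeff (coeff (coeff g i) j) k \<noteq> 0 \<longrightarrow> j < n \<and> k < n" by blast
  then obtain B where B: "\<And>i j k. coeff (coeff (coeff g i) j) k \<noteq> 0 \<Longrightarrow> j < B i \<and> k < B i"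
    by (auto dest!: choice)
  obtain n where n: "\<And>i. coeff g i \<noteq> 0 \<Longrightarrow> B i \<le> n \<and> i < n" using fin[of g B] by blast
  have "i < n \<and> j < n \<and> k < n" if "coeff (coeff (coeff g i) j) k \<noteq> 0" for i j k
  proof -
    have "coeff g i \<noteq> 0" using that by auto
    then show ?thesis using n[of i] B[OF that] by linarith
  qed
  then show ?thesis by blast
qed

text \<open>The inverses of \<open>\<xi> - c\<close>, for the uncountably many scalars \<open>c\<close>, are linearly
  dependent in a localisation of countable dimension, and a dependency clears to a
  polynomial relation for \<open>\<xi>\<close>.\<close>

lemma prime_ideal_contains_linear:
  assumes N: "is_prime_ideal N" and w: "w \<notin> N"
    and inv: "\<And>c. \<exists>g k. (\<xi> - const3 c) * g - w ^ k \<in> N"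
  shows "\<exists>c. \<xi> - const3 c \<in> N"
proof -
  note ideal = prime_idealD(1)[OF N]
  obtain G K where GK: "\<And>c. (\<xi> - const3 c) * G c - w ^ K c \<in> N" using inv by metis
  obtain B where B: "\<And>c i j k. coeff (coeff (coeff (G c) i) j) k \<noteq> 0 \<Longrightarrow> i < B c \<and> j < B c \<and> k < B c"
  proof -
    have "\<forall>c. \<exists>n. \<forall>i j k. coeff (coeff (coeff (G c) i) j) k \<noteq> 0 \<longrightarrow> i < n \<and> j < n \<and> k < n"
      using cpoly3_bounded by blast
    then show ?thesis using that by (auto dest!: choice)
  qed
  \<comment> \<open>Pigeonhole: there are uncountably many real scalars but only countably many
    pairs of an exponent bound and a power of \<open>w\<close>.\<close>
  have "\<exists>n k. infinite {r :: real. B (of_real r) = n \<and> K (of_real r) = k}"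
  proof (rule ccontr)
    assume "\<not> ?thesis"
    then have "countable (\<Union>n k. {r :: real. B (of_real r) = n \<and> K (of_real r) = k})"
      by (intro countable_UN) (simp_all add: countable_finite)
    moreover have "(\<Union>n k. {r :: real. B (of_real r) = n \<and> K (of_real r) = k}) = UNIV" by auto
    ultimately show False using uncountable_UNIV_real by simp
  qed
  then obtain n k where inf: "infinite {r :: real. B (of_real r) = n \<and> K (of_real r) = k}" by blast
  define I where "I = {..<n} \<times> {..<n} \<times> {..<n}"
  \<comment> \<open>One scalar more than there are monomials with exponents below \<open>n\<close>
    forces a linear dependency among the \<open>G c\<close>.\<close>
  obtain R where R: "finite R" "card R = Suc (card I)" "R \<subseteq> {r :: real. B (of_real r) = n \<and> K (of_real r) = k}"
    using infinite_arbitrarily_large[OF inf] by blast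
  define S where "S = (of_real ` R :: complex set)"
  have S: "finite S" "card S = Suc (card I)" "\<And>c. c \<in> S \<Longrightarrow> B c = n \<and> K c = k"
    using R by (auto simp: S_def card_image inj_on_def)
  have "finite I" "card I < card S" by (simp_all add: I_def S(2))
  then obtain l where l: "\<exists>c\<in>S. l c \<noteq> 0"
    "\<And>i. i \<in> I \<Longrightarrow> (\<Sum>c\<in>S. l c * (case i of (x, y, z) \<Rightarrow> coeff (coeff (coeff (G c) x) y) z)) = 0"
    using homogeneous_system_nontrivial_solution[OF _ S(1), of I
        "\<lambda>c i. case i of (x, y, z) \<Rightarrow> coeff (coeff (coeff (G c) x) y) z"] by blast
  have dep: "(\<Sum>c\<in>S. const3 (l c) * G c) = 0"
  proof (rule poly3_eqI)
    fix x y z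
    have "coeff (coeff (coeff (\<Sum>c\<in>S. const3 (l c) * G c) x) y) z
        = (\<Sum>c\<in>S. l c * coeff (coeff (coeff (G c) x) y) z)"
      by (simp add: coeff_sum const3_def)
    also have "\<dots> = 0"
    proof (cases "(x, y, z) \<in> I")
      case True
      then show ?thesis using l(2)[OF True] by simp
    next
      case False
      have "coeff (coeff (coeff (G c) x) y) z = 0" if "c \<in> S" for c
        using B[of c x y z] S(3)[OF that] False by (auto simp: I_def)
      then show ?thesis by simp
    qed
    finally show "coeff (coeff (coeff (\<Sum>c\<in>S. const3 (l c) * G c) x) y) z = coeff (coeff (coeff 0 x) y) z"
      by simp
  qed
  \<comment> \<open>The numerator of the sum of the fractions \<open>l c / (T - c)\<close>, in an
    indeterminate \<open>T\<close>, over their common denominator.\<close>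
  define q where "q = (\<Sum>c\<in>S. smult (l c) (\<Prod>d\<in>S - {c}. [:- d, 1:]))"
  have q: "eval_at q \<xi> = (\<Sum>c\<in>S. const3 (l c) * (\<Prod>d\<in>S - {c}. \<xi> - const3 d))"
    by (simp add: q_def eval_at_sum eval_at_smult eval_at_prod eval_at_linear)
  have "q \<noteq> 0"
  proof
    assume "q = 0"
    obtain e where e: "e \<in> S" "l e \<noteq> 0" using l(1) by blast
    \<comment> \<open>At a pole \<open>e\<close> with nonzero coefficient every other summand
      contains the factor \<open>e - e\<close>.\<close>
    have "poly q e = (\<Sum>c\<in>S. l c * (\<Prod>d\<in>S - {c}. e - d))" by (simp add: q_def poly_sum poly_prod)
    also have "\<dots> = (\<Sum>c\<in>S. if c = e then l e * (\<Prod>d\<in>S - {e}. e - d) else 0)"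
      using e S(1) by (intro sum.cong) auto
    also have "\<dots> = l e * (\<Prod>d\<in>S - {e}. e - d)" using e S(1) by simp
    also have "\<dots> \<noteq> 0" using e S(1) by simp
    finally show False using \<open>q = 0\<close> by simp
  qed
  \<comment> \<open>Modulo \<open>N\<close> each \<open>w ^ k\<close> may be replaced by
    \<open>(\<xi> - const3 c) * G c\<close>, which turns the left side into a multiple of the
    dependency.\<close>
  have "w ^ k * eval_at q \<xi> = - (\<Sum>c\<in>S. const3 (l c) * (\<Prod>d\<in>S - {c}. \<xi> - const3 d)
      * ((\<xi> - const3 c) * G c - w ^ k)) + (\<Prod>d\<in>S. \<xi> - const3 d) * (\<Sum>c\<in>S. const3 (l c) * G c)"
  proof -
    have "(\<Prod>d\<in>S. \<xi> - const3 d) * (\<Sum>c\<in>S. const3 (l c) * G c)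
        = (\<Sum>c\<in>S. const3 (l c) * (\<Prod>d\<in>S - {c}. \<xi> - const3 d) * ((\<xi> - const3 c) * G c))"
      unfolding sum_distrib_left
    proof (rule sum.cong[OF refl])
      fix c assume "c \<in> S"
      then have "(\<Prod>d\<in>S. \<xi> - const3 d) = (\<xi> - const3 c) * (\<Prod>d\<in>S - {c}. \<xi> - const3 d)"
        using S(1) by (simp add: prod.remove)
      then show "(\<Prod>d\<in>S. \<xi> - const3 d) * (const3 (l c) * G c)
          = const3 (l c) * (\<Prod>d\<in>S - {c}. \<xi> - const3 d) * ((\<xi> - const3 c) * G c)"
        by (simp only: mult_ac)
    qed
    then show ?thesis
      by (simp add: q sum_distrib_left right_diff_distrib sum_subtractf mult_ac)
  qed
  also have "\<dots> \<in> N"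
  proof -
    have "(\<xi> - const3 c) * G c - w ^ k \<in> N" if "c \<in> S" for c using GK[of c] S(3)[OF that] by simp
    then show ?thesis
      unfolding dep mult_zero_right add_0_right
      by (intro ideal_minus[OF ideal] ideal_sum[OF ideal] ideal_mult[OF ideal])
  qed
  finally have "eval_at q \<xi> \<in> N"
    using prime_idealD(3)[OF N] prime_ideal_power[OF N] w by blast
  then show ?thesis by (rule prime_ideal_linear_factor[OF N \<open>q \<noteq> 0\<close>])
qed

lemma is_ideal_adjoin:
  assumes "is_ideal N"
  shows "is_ideal {n + a * f | n a. n \<in> N}"
  unfolding is_ideal_def
proof (intro conjI ballI allI)
  show "0 \<in> {n + a * f | n a. n \<in> N}"
    using ideal_zero[OF assms] by (auto intro!: exI[where x = 0])
next
  fix x y assume "x \<in> {n + a * f | n a. n \<in> N}" "y \<in> {n + a * f | n a. n \<in> N}"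
  then obtain n a m b where "n \<in> N" "m \<in> N" "x = n + a * f" "y = m + b * f" by blast
  then have "x + y = (n + m) + (a + b) * f" "n + m \<in> N"
    using assms by (auto simp: algebra_simps intro: ideal_closed)
  then show "x + y \<in> {n + a * f | n a. n \<in> N}" by blast
next
  fix r x assume "x \<in> {n + a * f | n a. n \<in> N}"
  then obtain n a where "n \<in> N" "x = n + a * f" by blast
  then have "r * x = r * n + (r * a) * f" "r * n \<in> N"
    using assms by (auto simp: algebra_simps intro: ideal_closed)
  then show "r * x \<in> {n + a * f | n a. n \<in> N}" by blast
qed

lemma adjoin_superset: "(N :: cpoly3 set) \<subseteq> {n + a * f | n a. n \<in> N}"
proof
  fix n assume "n \<in> N"
  moreover have "n = n + 0 * f" by simp
  ultimately show "n \<in> {n + a * f | n a. n \<in> N}" by blast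
qed

lemma adjoin_member: "is_ideal N \<Longrightarrow> f \<in> {n + a * f | n a. n \<in> N}"
proof -
  assume "is_ideal N"
  moreover have "f = 0 + 1 * f" by simp
  ultimately show ?thesis using ideal_zero by blast
qed

text \<open>An ideal \<open>N\<close> maximal among those that contain \<open>I\<close> and no power
  of \<open>w\<close> is prime, and every element outside it becomes invertible modulo
  \<open>N\<close> once \<open>w\<close> is inverted. Hence each coordinate is congruent to a scalar
  modulo \<open>N\<close>, so \<open>N\<close> is the ideal of a point where \<open>w\<close> does
  not vanish.\<close>

lemma nullstellensatz:
  assumes "is_ideal I" "\<And>n. w ^ n \<notin> I"
  shows "\<exists>\<alpha> \<beta> \<gamma>. I \<subseteq> max_ideal_at \<alpha> \<beta> \<gamma> \<and> w \<notin> max_ideal_at \<alpha> \<beta> \<gamma>"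
proof -
  define S where "S = {N. is_ideal N \<and> I \<subseteq> N \<and> (\<forall>n. w ^ n \<notin> N)}"
  have "\<exists>N\<in>S. \<forall>X\<in>S. N \<subseteq> X \<longrightarrow> X = N"
  proof (rule subset_Zorn_nonempty)
    show "S \<noteq> {}" using assms by (auto simp: S_def)
  next
    fix C assume C: "C \<noteq> {}" "subset.chain S C"
    then have sub: "C \<subseteq> S" and total: "\<And>X Y. X \<in> C \<Longrightarrow> Y \<in> C \<Longrightarrow> X \<subseteq> Y \<or> Y \<subseteq> X"
      by (auto simp: subset.chain_def)
    have "a + b \<in> \<Union>C" if ab: "a \<in> \<Union>C" "b \<in> \<Union>C" for a b
    proof -
      obtain X Y where XY: "X \<in> C" "Y \<in> C" "a \<in> X" "b \<in> Y" using ab by blast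
      then obtain Z where "Z \<in> C" "a \<in> Z" "b \<in> Z" using total[of X Y] by blast
      moreover have "is_ideal Z" using \<open>Z \<in> C\<close> sub by (auto simp: S_def)
      ultimately show ?thesis by (blast intro: ideal_closed)
    qed
    moreover have "r * a \<in> \<Union>C" if "a \<in> \<Union>C" for r a
      using that sub unfolding S_def is_ideal_def by blast
    moreover have "0 \<in> \<Union>C" using C(1) sub by (auto simp: S_def is_ideal_def)
    ultimately have "is_ideal (\<Union>C)" unfolding is_ideal_def by blast
    then show "\<Union>C \<in> S" using C(1) sub unfolding S_def by blast
  qed
  then obtain N where NS: "N \<in> S" and max: "\<And>X. X \<in> S \<Longrightarrow> N \<subseteq> X \<Longrightarrow> X = N" by blast
  have N: "is_ideal N" "I \<subseteq> N" "\<And>n. w ^ n \<notin> N" using NS by (auto simp: S_def)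
  \<comment> \<open>Adjoining \<open>f\<close> to \<open>N\<close> must bring in a power of
    \<open>w\<close>, by maximality.\<close>
  have inv: "\<exists>g k. f * g - w ^ k \<in> N" if "f \<notin> N" for f
  proof -
    let ?X = "{n + a * f | n a. n \<in> N}"
    have "?X \<notin> S" using max[of ?X] adjoin_superset[of N f] adjoin_member[OF N(1), of f] that by blast
    then obtain k where "w ^ k \<in> ?X"
      using is_ideal_adjoin[OF N(1)] adjoin_superset[of N f] N(2) by (auto simp: S_def)
    then obtain n a where "n \<in> N" "w ^ k = n + a * f" by blast
    then have "f * a - w ^ k \<in> N" using ideal_minus[OF N(1)] by (simp add: algebra_simps)
    then show ?thesis by blast
  qed
  have prime: "is_prime_ideal N"
    unfolding is_prime_ideal_def
  proof (intro conjI allI impI)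
    show "is_ideal N" by fact
    show "N \<noteq> UNIV" using N(3) by blast
    fix a b assume ab: "a * b \<in> N"
    show "a \<in> N \<or> b \<in> N"
    proof (rule ccontr)
      assume "\<not> ?thesis"
      then obtain g k h l where gk: "a * g - w ^ k \<in> N" and hl: "b * h - w ^ l \<in> N"
        using inv by meson
      have "w ^ (k + l) = (g * h) * (a * b) - (a * g - w ^ k) * (b * h) - w ^ k * (b * h - w ^ l)"
        by (simp add: algebra_simps power_add)
      also have "\<dots> \<in> N"
        by (rule ideal_diff[OF N(1) ideal_diff[OF N(1) ideal_mult[OF N(1) ab] ideal_mult_right[OF N(1) gk]]
              ideal_mult[OF N(1) hl]])
      finally show False using N(3) by blast
    qed
  qed
  have w: "w \<notin> N" using N(3)[of 1] by simp
  have "\<exists>c. \<xi> - const3 c \<in> N" for \<xi>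
    using prime_ideal_contains_linear[OF prime w, of \<xi>] inv by blast
  then obtain \<alpha> \<beta> \<gamma> where "varX - const3 \<alpha> \<in> N" "varY - const3 \<beta> \<in> N" "varZ - const3 \<gamma> \<in> N"
    by blast
  then have "max_ideal_at \<alpha> \<beta> \<gamma> \<subseteq> N" by (rule max_ideal_at_subset_ideal[OF N(1)])
  moreover have "N \<noteq> UNIV" using w by blast
  ultimately have "N = max_ideal_at \<alpha> \<beta> \<gamma>"
    using is_maximal_ideal_max_ideal_at[of \<alpha> \<beta> \<gamma>] N(1) unfolding is_maximal_ideal_def by blast
  then show ?thesis using N(2) w by blast
qed

lemma prime_nullstellensatz:
  assumes "is_prime_ideal P" "w \<notin> P"
  obtains \<alpha> \<beta> \<gamma> where "P \<subseteq> max_ideal_at \<alpha> \<beta> \<gamma>" "w \<notin> max_ideal_at \<alpha> \<beta> \<gamma>"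
proof -
  have "w ^ n \<notin> P" for n using assms prime_ideal_power by blast
  then show thesis using nullstellensatz[OF prime_idealD(1)[OF assms(1)], of w] that by blast
qed

text \<open>The Nullstellensatz with \<open>w = 1\<close>, where avoiding the powers of
  \<open>w\<close> just means being proper.\<close>

lemma maximal_ideal_iff: "is_maximal_ideal M \<longleftrightarrow> (\<exists>\<alpha> \<beta> \<gamma>. M = max_ideal_at \<alpha> \<beta> \<gamma>)"
proof
  assume M: "is_maximal_ideal M"
  then have "1 ^ n \<notin> M" for n :: nat
    using ideal_eq_UNIV_iff unfolding is_maximal_ideal_def power_one by blast
  then obtain \<alpha> \<beta> \<gamma> where "M \<subseteq> max_ideal_at \<alpha> \<beta> \<gamma>"
    using nullstellensatz[of M 1] M unfolding is_maximal_ideal_def by blast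
  moreover have "max_ideal_at \<alpha> \<beta> \<gamma> \<noteq> UNIV"
    using is_prime_ideal_max_ideal_at by (simp add: is_prime_ideal_def)
  ultimately show "\<exists>\<alpha> \<beta> \<gamma>. M = max_ideal_at \<alpha> \<beta> \<gamma>"
    using M is_ideal_max_ideal_at unfolding is_maximal_ideal_def by metis
qed (auto simp: is_maximal_ideal_max_ideal_at)

section \<open>Poisson ideals\<close>

text \<open>The Jacobian determinant of the three polynomials, expanded along the gradient of
  \<open>h\<close>.\<close>

definition jac :: "cpoly3 \<Rightarrow> cpoly3 \<Rightarrow> cpoly3 \<Rightarrow> cpoly3" where
  "jac f g h = (dX f * dY g - dY f * dX g) * dZ h + (dY f * dZ g - dZ f * dY g) * dX h
     + (dZ f * dX g - dX f * dZ g) * dY h"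

lemma pbr_jac: "pbr s t f g = t * jac f g s - s * jac f g t"
  unfolding pbr_def jac_def by algebra

lemma jac_swap: "jac a g f = - jac a f g"
  unfolding jac_def by algebra

lemma jac_same: "jac a f f = 0"
  unfolding jac_def by algebra

lemma jac_add: "jac a (f + g) h = jac a f h + jac a g h"
  unfolding jac_def dX.add dY.add dZ.add by algebra

lemma jac_mult: "jac a (f * g) h = f * jac a g h + jac a f h * g"
  unfolding jac_def dX.mult dY.mult dZ.mult by algebra

lemma jac_const: "jac a (const3 c) h = 0"
  by (simp add: jac_def)

lemma pbr_add: "pbr s t a (f + g) = pbr s t a f + pbr s t a g"
  unfolding pbr_jac jac_add by algebra

lemma pbr_mult: "pbr s t a (f * g) = f * pbr s t a g + pbr s t a f * g"
  unfolding pbr_jac jac_mult by algebra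

lemma pbr_const: "pbr s t a (const3 c) = 0"
  by (simp add: pbr_jac jac_const)

lemma pbr_diff: "pbr s t a (f - g) = pbr s t a f - pbr s t a g"
  using pbr_add[of s t a "f - g" g] by simp

lemma pbr_swap: "pbr s t f g = - pbr s t g f"
  unfolding pbr_def by algebra

text \<open>The extra factor \<open>b\<close> avoids the exponent \<open>n - 1\<close>, which would
  be truncated at \<open>n = 0\<close>.\<close>

lemma pbr_power: "b * pbr s t a (b ^ n) = of_nat n * pbr s t a b * b ^ n"
proof (induction n)
  case 0
  then show ?case using pbr_const[of s t a 1] by (simp add: const3_simps)
next
  case (Suc n)
  have "b * pbr s t a (b ^ Suc n) = b * (b * pbr s t a (b ^ n)) + pbr s t a b * b ^ Suc n"
    by (simp add: pbr_mult algebra_simps)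
  also have "\<dots> = of_nat (Suc n) * pbr s t a b * b ^ Suc n"
    unfolding Suc by (simp add: algebra_simps)
  finally show ?case .
qed

definition wronskian :: "(cpoly3 \<Rightarrow> cpoly3) \<Rightarrow> cpoly3 \<Rightarrow> cpoly3 \<Rightarrow> cpoly3" where
  "wronskian D s t = t * D s - s * D t"

definition wronskians :: "cpoly3 \<Rightarrow> cpoly3 \<Rightarrow> cpoly3 set" where
  "wronskians s t = {wronskian dX s t, wronskian dY s t, wronskian dZ s t}"

lemma pbr_wronskian:
  "pbr s t f g = (dX f * dY g - dY f * dX g) * wronskian dZ s t
     + (dY f * dZ g - dZ f * dY g) * wronskian dX s t
     + (dZ f * dX g - dX f * dZ g) * wronskian dY s t"
  by (simp add: pbr_def wronskian_def)

lemma wronskian_derivations: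
  assumes "w \<in> wronskians s t"
  obtains D where "D \<in> {dX, dY, dZ}" "w = wronskian D s t"
  using assms by (auto simp: wronskians_def)

lemma pbr_in_ideal:
  assumes "is_ideal I" "wronskians s t \<subseteq> I"
  shows "pbr s t f g \<in> I"
  using assms unfolding pbr_wronskian wronskians_def by (intro ideal_add ideal_mult) auto

lemma poisson_idealD: "poisson_ideal s t I \<Longrightarrow> is_ideal I"
  "poisson_ideal s t I \<Longrightarrow> i \<in> I \<Longrightarrow> pbr s t a i \<in> I"
  by (auto simp: poisson_ideal_def)

lemma poisson_ideal_if_wronskians:
  "is_ideal I \<Longrightarrow> wronskians s t \<subseteq> I \<Longrightarrow> poisson_ideal s t I"
  by (auto simp: poisson_ideal_def intro: pbr_in_ideal)

text \<open>Shifting a coordinate by a constant leaves its brackets unchanged, and the brackets of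
  the coordinates with each other are the Wronskians.\<close>

lemma poisson_max_ideal_at_iff:
  "poisson_ideal s t (max_ideal_at \<alpha> \<beta> \<gamma>) \<longleftrightarrow> wronskians s t \<subseteq> max_ideal_at \<alpha> \<beta> \<gamma>"
proof
  let ?M = "max_ideal_at \<alpha> \<beta> \<gamma>"
  assume P: "poisson_ideal s t ?M"
  have "varX - const3 \<alpha> \<in> ?M" "varY - const3 \<beta> \<in> ?M" "varZ - const3 \<gamma> \<in> ?M"
    by (simp_all add: max_ideal_at_eq)
  then have "pbr s t varX (varY - const3 \<beta>) \<in> ?M" "pbr s t varY (varZ - const3 \<gamma>) \<in> ?M"
    "pbr s t varZ (varX - const3 \<alpha>) \<in> ?M"
    using poisson_idealD(2)[OF P] by blast+
  then show "wronskians s t \<subseteq> ?M"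
    by (simp only: pbr_diff pbr_const) (simp add: pbr_wronskian wronskians_def)
qed (rule poisson_ideal_if_wronskians[OF is_ideal_max_ideal_at])

lemma derivation_member: "D \<in> {dX, dY, dZ} \<Longrightarrow> derivation D"
  using derivation_dX derivation_dY derivation_dZ by auto

section \<open>Members of the pencil and their factors\<close>

lemma derivative_pencil:
  assumes "D \<in> {dX, dY, dZ}"
  shows "D (pencil s t la mu) = const3 la * D s - const3 mu * D t"
  using assms by (auto simp: pencil_def dX.diff dX.mult dY.diff dY.mult dZ.diff dZ.mult)

text \<open>The Wronskian is bilinear and alternating, so pairing a member of the pencil with
  \<open>t\<close> or with \<open>s\<close> gives a scalar multiple of it. Both identities are kept
  because either scalar may be zero.\<close>

lemma wronskian_pencil:
  assumes "D \<in> {dX, dY, dZ}"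
  shows "t * D (pencil s t la mu) - pencil s t la mu * D t = const3 la * wronskian D s t"
    "s * D (pencil s t la mu) - pencil s t la mu * D s = const3 mu * wronskian D s t"
  unfolding derivative_pencil[OF assms] by (simp_all add: pencil_def wronskian_def algebra_simps)

lemma const3_dvd_cancel: "c \<noteq> 0 \<Longrightarrow> u dvd const3 c * f \<longleftrightarrow> u dvd f"
  using dvd_mult_unit_iff'[OF is_unit_const3[of c]] by blast

lemma dvd_wronskian:
  assumes "D \<in> {dX, dY, dZ}" "(la, mu) \<noteq> (0, 0)"
    and "u dvd pencil s t la mu" "u dvd D (pencil s t la mu)"
  shows "u dvd wronskian D s t"
proof -
  have "u dvd const3 la * wronskian D s t" "u dvd const3 mu * wronskian D s t"
    using assms(3,4) wronskian_pencil[OF assms(1), where s = s and t = t and la = la and mu = mu]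
    by (metis dvd_diff dvd_mult dvd_mult2)+
  then show ?thesis using assms(2) const3_dvd_cancel by fastforce
qed

text \<open>A repeated factor of a member of the pencil also divides its derivatives.\<close>

lemma square_dvd_imp_dvd_wronskian:
  assumes "w \<in> wronskians s t" "(la, mu) \<noteq> (0, 0)" "u * u dvd pencil s t la mu"
  shows "u dvd w"
proof -
  obtain D where D: "D \<in> {dX, dY, dZ}" "w = wronskian D s t"
    using assms(1) by (rule wronskian_derivations)
  interpret derivation D using D(1) by (rule derivation_member)
  obtain v where v: "pencil s t la mu = u * (u * v)" using assms(3) by (metis dvdE mult.assoc)
  have "u dvd D (pencil s t la mu)" unfolding v mult[of u] by simp
  moreover have "u dvd pencil s t la mu" by (simp add: v)
  ultimately show ?thesis using dvd_wronskian[OF D(1) assms(2)] D(2) by blast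
qed

text \<open>The preceding lemma with \<open>u = 0\<close>: linearly dependent \<open>s\<close> and
  \<open>t\<close> give the zero bracket.\<close>

lemma wronskians_zero_if_pencil_zero:
  assumes "(la, mu) \<noteq> (0, 0)" "pencil s t la mu = 0"
  shows "wronskians s t \<subseteq> {0}"
  using square_dvd_imp_dvd_wronskian[of _ s t la mu 0] assms by auto

text \<open>Bracketing with \<open>a\<close> multiplies \<open>s\<close> and \<open>t\<close> by one
  common cofactor, which then serves every member of the pencil. The common cofactor is also what
  makes \<open>s/t\<close> central.\<close>

lemma pbr_pencil: "pbr s t a (pencil s t la mu) = - pencil s t la mu * jac a s t"
proof -
  have "pbr s t a s = - s * jac a s t" "pbr s t a t = - t * jac a s t"
    by (simp_all add: pbr_jac jac_same jac_swap[of a s t])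
  then show ?thesis
    by (simp add: pencil_def pbr_diff pbr_mult pbr_const algebra_simps)
qed

lemma mem_principal_ideal: "f \<in> principal_ideal u \<longleftrightarrow> u dvd f"
  by (auto simp: principal_ideal_def dvd_def)

lemma is_ideal_principal: "is_ideal (principal_ideal u)"
  by (auto simp: is_ideal_def mem_principal_ideal)

lemma is_prime_ideal_principal:
  assumes "irreducible u"
  shows "is_prime_ideal (principal_ideal u)"
  unfolding is_prime_ideal_def
proof (intro conjI allI impI)
  show "is_ideal (principal_ideal u)" by (rule is_ideal_principal)
  show "principal_ideal u \<noteq> UNIV"
    using assms irreducible_not_unit mem_principal_ideal by blast
  fix a b assume "a * b \<in> principal_ideal u"
  then show "a \<in> principal_ideal u \<or> b \<in> principal_ideal u"
    using prime_elem_dvd_mult_iff[OF irreducible_imp_prime_elem[OF assms]]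
    by (simp add: mem_principal_ideal)
qed

lemma poisson_principalI:
  assumes "\<And>a. u dvd pbr s t a u"
  shows "poisson_ideal s t (principal_ideal u)"
  using assms is_ideal_principal by (auto simp: poisson_ideal_def mem_principal_ideal pbr_mult elim!: dvdE[of u])

lemma poisson_pencil: "poisson_ideal s t (principal_ideal (pencil s t la mu))"
  by (intro poisson_principalI) (simp add: pbr_pencil)

text \<open>For a simple factor the Leibniz rule leaves the bracket of \<open>u\<close> times the
  cofactor \<open>v\<close>, and primality cancels \<open>v\<close>. For a repeated factor all
  Wronskians, hence all brackets, are divisible by \<open>u\<close>.\<close>

lemma poisson_irreducible_factor:
  assumes "irreducible u" "(la, mu) \<noteq> (0, 0)" "u dvd pencil s t la mu"
  shows "poisson_ideal s t (principal_ideal u)"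
proof -
  obtain v where v: "pencil s t la mu = u * v" using assms(3) by (elim dvdE)
  show ?thesis
  proof (cases "u dvd v")
    case True
    then have "u * u dvd pencil s t la mu" by (simp add: v)
    then have "wronskians s t \<subseteq> principal_ideal u"
      using square_dvd_imp_dvd_wronskian[OF _ assms(2)] by (auto simp: mem_principal_ideal)
    then show ?thesis by (rule poisson_ideal_if_wronskians[OF is_ideal_principal])
  next
    case False
    show ?thesis
    proof (rule poisson_principalI)
      fix a
      have "u dvd pbr s t a (pencil s t la mu)" using assms(3) by (simp add: pbr_pencil)
      then have "u dvd pbr s t a u * v" unfolding v pbr_mult by (simp add: dvd_add_right_iff)
      then show "u dvd pbr s t a u"
        using False prime_elem_dvd_mult_iff[OF irreducible_imp_prime_elem[OF assms(1)]] by blast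
    qed
  qed
qed

lemma pencil_through_point:
  "\<exists>la mu. (la, mu) \<noteq> (0, 0) \<and> eval3 (pencil s t la mu) \<alpha> \<beta> \<gamma> = 0"
proof (cases "eval3 s \<alpha> \<beta> \<gamma> = 0 \<and> eval3 t \<alpha> \<beta> \<gamma> = 0")
  case True
  then have "eval3 (pencil s t 1 0) \<alpha> \<beta> \<gamma> = 0" by (simp add: pencil_def)
  then show ?thesis by (metis prod.inject zero_neq_one)
next
  case False
  then show ?thesis
    \<comment> \<open>The values of \<open>t\<close> and \<open>s\<close> at the point,
      interchanged, make the two terms cancel.\<close>
    by (intro exI[where x = "eval3 t \<alpha> \<beta> \<gamma>"] exI[where x = "eval3 s \<alpha> \<beta> \<gamma>"])
      (auto simp: pencil_def mult.commute)
qed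

lemma derivatives_commute:
  "D \<in> {dX, dY, dZ} \<Longrightarrow> E \<in> {dX, dY, dZ} \<Longrightarrow> D (E f) = E (D f)"
  using d_commute by auto

section \<open>Descent to a constant by differentiation\<close>

lemma last_nonzero_derivative:
  assumes "D \<in> {dX, dY, dZ}" "r \<noteq> 0"
  shows "\<exists>m. (D ^^ m) r \<noteq> 0 \<and> D ((D ^^ m) r) = 0"
proof -
  define n where "n = (LEAST n. (D ^^ n) r = 0)"
  have n: "(D ^^ n) r = 0" unfolding n_def using derivative_nilpotent[OF assms(1)] by (rule LeastI_ex)
  then have "n \<noteq> 0" using assms(2) by (auto intro: gr0I)
  then obtain m where m: "n = Suc m" by (cases n) auto
  then have "(D ^^ m) r \<noteq> 0" using not_less_Least[of m "\<lambda>n. (D ^^ n) r = 0"] by (simp add: n_def)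
  then show ?thesis using n m by auto
qed

text \<open>Differentiate along \<open>D1\<close> until one more step would give zero, then do the
  same along \<open>D2\<close>. Since partial derivatives commute, what is already killed stays
  killed, and the descent ends in a nonzero constant of \<open>J\<close>.\<close>

lemma differentiate_to_constant:
  assumes J: "is_ideal J" and D: "{D1, D2, D3} = {dX, dY, dZ}"
    and step: "\<And>h. h \<in> J \<Longrightarrow> D3 h = 0 \<Longrightarrow> D1 h \<in> J \<and> D2 h \<in> J"
    and r: "r \<in> J" "r \<noteq> 0" "D3 r = 0"
  shows "J = UNIV"
proof -
  have mem: "D1 \<in> {dX, dY, dZ}" "D2 \<in> {dX, dY, dZ}" "D3 \<in> {dX, dY, dZ}" using D by auto
  have zero: "E 0 = 0" if "E \<in> {dX, dY, dZ}" for E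
    using derivation.zero[OF derivation_member[OF that]] .
  \<comment> \<open>The last conjunct is for the second round, where differentiating along
    \<open>D2\<close> must not undo the first.\<close>
  have iterate: "(E ^^ m) f \<in> J \<and> D3 ((E ^^ m) f) = 0 \<and> (D1 f = 0 \<longrightarrow> D1 ((E ^^ m) f) = 0)"
    if "E \<in> {D1, D2}" "f \<in> J" "D3 f = 0" for E f m
  proof (induction m)
    case (Suc m)
    have E: "E \<in> {dX, dY, dZ}" using that(1) mem by auto
    have "E ((E ^^ m) f) \<in> J" using that(1) step Suc by auto
    moreover have "D3 (E ((E ^^ m) f)) = 0"
      using derivatives_commute[OF mem(3) E] Suc zero[OF E] by simp
    moreover have "D1 f = 0 \<longrightarrow> D1 (E ((E ^^ m) f)) = 0"
      using derivatives_commute[OF mem(1) E] Suc zero[OF E] by simp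
    ultimately show ?case by simp
  qed (use that in auto)
  obtain m where m: "(D1 ^^ m) r \<noteq> 0" "D1 ((D1 ^^ m) r) = 0"
    using last_nonzero_derivative[OF mem(1) r(2)] by blast
  define r1 where "r1 = (D1 ^^ m) r"
  have r1: "r1 \<in> J" "D3 r1 = 0" "D1 r1 = 0" "r1 \<noteq> 0"
    using iterate[of D1 r m] r m by (auto simp: r1_def)
  obtain n where n: "(D2 ^^ n) r1 \<noteq> 0" "D2 ((D2 ^^ n) r1) = 0"
    using last_nonzero_derivative[OF mem(2) r1(4)] by blast
  define r2 where "r2 = (D2 ^^ n) r1"
  have r2: "r2 \<in> J" "D3 r2 = 0" "D1 r2 = 0" "D2 r2 = 0" "r2 \<noteq> 0"
    using iterate[of D2 r1 n] r1 n by (auto simp: r2_def)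
  have "E r2 = 0" if "E \<in> {dX, dY, dZ}" for E
    using r2 that unfolding D[symmetric] by auto
  then obtain c where "r2 = const3 c" using const3_if_derivatives_zero[of r2] by blast
  then show ?thesis using r2 is_unit_const3[of c] is_unit_in_ideal[OF J] by auto
qed

text \<open>On a polynomial \<open>h\<close> free of one variable, bracketing with the other two is
  differentiation up to the factor \<open>w\<close>.\<close>

lemma poisson_ideal_coprime_pair:
  assumes J: "poisson_ideal s t J" and w: "w \<in> wronskians s t"
    and sat: "\<And>h. w * h \<in> J \<Longrightarrow> h \<in> J"
    and ug: "u \<in> J" "g \<in> J" "coprime u g" "u \<noteq> 0"
  shows "J = UNIV"
proof -
  note ideal = poisson_idealD(1)[OF J]
  \<comment> \<open>The negative is needed because one of the two coordinate brackets gives the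
    derivative with a minus sign.\<close>
  have br: "pbr s t v h \<in> J" "- pbr s t v h \<in> J" if "h \<in> J" for v h
    using poisson_idealD(2)[OF J that] ideal_minus[OF ideal] by blast+
  have elim: "\<exists>r\<in>J. r \<noteq> 0 \<and> D r = 0" if "D \<in> {dX, dY, dZ}" for D
    using eliminate_variable[OF that ug(3,4)] ug(1,2) ideal by (metis ideal_add ideal_mult)
  consider "w = wronskian dZ s t" | "w = wronskian dX s t" | "w = wronskian dY s t"
    using w by (auto simp: wronskians_def)
  then show ?thesis
  proof cases
    case 1
    obtain r where r: "r \<in> J" "r \<noteq> 0" "dZ r = 0" using elim[of dZ] by blast
    have "dX h \<in> J \<and> dY h \<in> J" if "h \<in> J" "dZ h = 0" for h
      using br[OF that(1), of varX] br[OF that(1), of varY] that(2) sat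
      by (auto simp: pbr_wronskian 1 mult.commute)
    with r show ?thesis
      by (intro differentiate_to_constant[of J dX dY dZ r] ideal) auto
  next
    case 2
    obtain r where r: "r \<in> J" "r \<noteq> 0" "dX r = 0" using elim[of dX] by blast
    have "dY h \<in> J \<and> dZ h \<in> J" if "h \<in> J" "dX h = 0" for h
      using br[OF that(1), of varY] br[OF that(1), of varZ] that(2) sat
      by (auto simp: pbr_wronskian 2 mult.commute)
    with r show ?thesis
      by (intro differentiate_to_constant[of J dY dZ dX r] ideal) auto
  next
    case 3
    obtain r where r: "r \<in> J" "r \<noteq> 0" "dY r = 0" using elim[of dY] by blast
    have "dZ h \<in> J \<and> dX h \<in> J" if "h \<in> J" "dY h = 0" for h
      using br[OF that(1), of varZ] br[OF that(1), of varX] that(2) sat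
      by (auto simp: pbr_wronskian 3 mult.commute)
    with r show ?thesis
      by (intro differentiate_to_constant[of J dZ dX dY r] ideal) auto
  qed
qed

section \<open>Saturation and Poisson cores\<close>

text \<open>For an ideal \<open>I\<close> this is the contraction to A of its extension to the
  localisation at \<open>b\<close>.\<close>

definition saturation :: "cpoly3 \<Rightarrow> cpoly3 set \<Rightarrow> cpoly3 set" where
  "saturation b I = {h. \<exists>n. b ^ n * h \<in> I}"

lemma subset_saturation: "I \<subseteq> saturation b I"
proof
  fix h assume "h \<in> I"
  then have "b ^ 0 * h \<in> I" by simp
  then show "h \<in> saturation b I" unfolding saturation_def by blast
qed

lemma saturation_cancel: "b * h \<in> saturation b I \<Longrightarrow> h \<in> saturation b I"
proof -
  assume "b * h \<in> saturation b I"
  then obtain n where "b ^ n * (b * h) \<in> I" by (auto simp: saturation_def)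
  then have "b ^ Suc n * h \<in> I" by (simp add: mult_ac)
  then show ?thesis unfolding saturation_def by blast
qed

lemma saturation_subset_prime:
  "is_prime_ideal M \<Longrightarrow> I \<subseteq> M \<Longrightarrow> b \<notin> M \<Longrightarrow> saturation b I \<subseteq> M"
  unfolding saturation_def using prime_idealD(3) prime_ideal_power by blast

text \<open>The bracket of a power \<open>b ^ n\<close> is absorbed by one more factor
  \<open>b\<close>. Closure of \<open>I\<close> up to that factor therefore suffices, and central
  fractions supply no more than this.\<close>

lemma poisson_saturation:
  assumes I: "is_ideal I" and b: "\<And>a h. h \<in> I \<Longrightarrow> b * pbr s t a h \<in> I"
  shows "poisson_ideal s t (saturation b I)"
  unfolding poisson_ideal_def is_ideal_def
proof (intro conjI ballI allI)
  show "0 \<in> saturation b I" using subset_saturation ideal_zero[OF I] by blast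
next
  fix x y assume "x \<in> saturation b I" "y \<in> saturation b I"
  then obtain m n where "b ^ m * x \<in> I" "b ^ n * y \<in> I" by (auto simp: saturation_def)
  then have "b ^ n * (b ^ m * x) + b ^ m * (b ^ n * y) \<in> I"
    using ideal_add[OF I] ideal_mult[OF I] by blast
  moreover have "b ^ n * (b ^ m * x) + b ^ m * (b ^ n * y) = b ^ (m + n) * (x + y)"
    by (simp add: algebra_simps power_add)
  ultimately show "x + y \<in> saturation b I" unfolding saturation_def by auto
next
  fix r x assume "x \<in> saturation b I"
  then obtain n where "b ^ n * x \<in> I" by (auto simp: saturation_def)
  then have "b ^ n * (r * x) \<in> I" using ideal_mult[OF I, of "b ^ n * x" r] by (simp add: mult_ac)
  then show "r * x \<in> saturation b I" unfolding saturation_def by blast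
next
  fix a x assume "x \<in> saturation b I"
  then obtain n where n: "b ^ n * x \<in> I" by (auto simp: saturation_def)
  have "b * pbr s t a (b ^ n * x) = b ^ Suc n * pbr s t a x + (b * pbr s t a (b ^ n)) * x"
    by (simp add: pbr_mult algebra_simps)
  then have "b ^ Suc n * pbr s t a x
      = b * pbr s t a (b ^ n * x) - (of_nat n * pbr s t a b) * (b ^ n * x)"
    unfolding pbr_power by (simp add: algebra_simps)
  also have "\<dots> \<in> I" by (intro ideal_diff ideal_mult I b n)
  finally show "pbr s t a x \<in> saturation b I" unfolding saturation_def by blast
qed

lemma irreducible_coprime_if_not_dvd:
  assumes "irreducible u" "\<not> u dvd (g :: cpoly3)"
  shows "coprime u g"
  using assms irreducible_imp_prime_elem prime_elem_imp_coprime by blast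

lemma adjoin_principal:
  assumes "is_ideal I"
  shows "is_ideal {n + a * u | n a. n \<in> I}" and "I \<subseteq> {n + a * u | n a. n \<in> I}"
    and "u \<in> {n + a * u | n a. n \<in> I}"
  using assms is_ideal_adjoin adjoin_superset adjoin_member by blast+

text \<open>Suppose a Poisson ideal \<open>Q\<close> inside \<open>M\<close> had an element
  \<open>g\<close> not divisible by \<open>u\<close>. The saturation at \<open>w\<close> of
  \<open>Q\<close> enlarged by \<open>u\<close> is Poisson and still inside \<open>M\<close>, yet it
  contains the coprime pair \<open>u\<close>, \<open>g\<close> and so is everything.\<close>

lemma core_of_generic_point:
  assumes u: "irreducible u" "poisson_ideal s t (principal_ideal u)"
    and w: "w \<in> wronskians s t"
    and M: "is_prime_ideal M" "principal_ideal u \<subseteq> M" "w \<notin> M"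
  shows "is_poisson_core s t M (principal_ideal u)"
  unfolding is_poisson_core_def
proof (intro conjI allI impI subsetI)
  fix Q g assume Q: "poisson_ideal s t Q \<and> Q \<subseteq> M" and g: "g \<in> Q"
  show "g \<in> principal_ideal u"
  proof (rule ccontr)
    assume "g \<notin> principal_ideal u"
    then have cop: "coprime u g"
      using irreducible_coprime_if_not_dvd[OF u(1)] by (simp add: mem_principal_ideal)
    let ?I = "{n + a * u | n a. n \<in> Q}"
    have Qi: "is_ideal Q" using Q by (auto dest: poisson_idealD)
    note I = adjoin_principal[OF Qi, of u]
    have Iu: "u dvd pbr s t b u" for b
      using u(2) by (auto simp: poisson_ideal_def mem_principal_ideal)
    have br: "pbr s t b h \<in> ?I" if "h \<in> ?I" for b h
    proof -
      obtain n a where h: "h = n + a * u" "n \<in> Q" using \<open>h \<in> ?I\<close> by blast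
      obtain k where k: "pbr s t b u = u * k" using Iu[of b] by (elim dvdE)
      have "pbr s t b h = pbr s t b n + (a * k + pbr s t b a) * u"
        by (simp add: h pbr_add pbr_mult k algebra_simps)
      moreover have "pbr s t b n \<in> Q" using Q h by (auto dest: poisson_idealD)
      ultimately show ?thesis by blast
    qed
    have P: "poisson_ideal s t (saturation w ?I)"
      by (intro poisson_saturation ideal_mult I(1) br)
    have "u \<in> M" using M(2) by (auto simp: mem_principal_ideal)
    then have "?I \<subseteq> M" using Q prime_idealD(1)[OF M(1)] by (auto intro: ideal_add ideal_mult)
    then have "saturation w ?I \<subseteq> M" by (rule saturation_subset_prime[OF M(1) _ M(3)])
    moreover have "saturation w ?I = UNIV"
    proof (rule poisson_ideal_coprime_pair[OF P w])
      show "u \<in> saturation w ?I" "g \<in> saturation w ?I"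
        using I(2,3) g subset_saturation[of ?I w] by blast+
      show "u \<noteq> 0" using u(1) by auto
    qed (use cop saturation_cancel in auto)
    ultimately show False using prime_idealD(2)[OF M(1)] by blast
  qed
qed (use u M in auto)

section \<open>Poisson primes of height at most one\<close>

lemma prime_ideal_irreducible_element:
  assumes "is_prime_ideal Q" "f \<in> Q" "f \<noteq> 0"
  shows "\<exists>u. irreducible u \<and> u \<in> Q"
  using assms(2,3)
proof (induction f rule: prime_divisors_induct)
  case (unit x)
  then show ?case using assms(1) is_unit_in_ideal by (auto simp: is_prime_ideal_def)
next
  case (factor p x)
  have "p \<in> Q \<or> x \<in> Q" using factor.prems prime_idealD(3)[OF assms(1)] by blast
  moreover have "irreducible p" using factor.hyps by (simp add: prime_elem_imp_irreducible)
  ultimately show ?case using factor by auto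
qed auto

text \<open>A prime avoiding \<open>w\<close> is already saturated at \<open>w\<close>. An
  irreducible element of it must divide all the others, since a coprime pair would make the ideal
  everything.\<close>

lemma poisson_prime_height_le_1:
  assumes Q: "poisson_prime s t Q" and w: "w \<in> wronskians s t" "w \<notin> Q"
  shows "Q = {0} \<or> (\<exists>u. irreducible u \<and> Q = principal_ideal u)"
proof (cases "Q = {0}")
  case False
  have P: "poisson_ideal s t Q" "is_prime_ideal Q" using Q by (auto simp: poisson_prime_def)
  have "0 \<in> Q" using P(1) by (auto dest: poisson_idealD intro: ideal_zero)
  then obtain f where "f \<in> Q" "f \<noteq> 0" using False by blast
  then obtain u where u: "irreducible u" "u \<in> Q" using prime_ideal_irreducible_element[OF P(2)] by blast
  have "u dvd g" if "g \<in> Q" for g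
  proof (rule ccontr)
    assume "\<not> u dvd g"
    then have "coprime u g" by (rule irreducible_coprime_if_not_dvd[OF u(1)])
    moreover have "h \<in> Q" if "w * h \<in> Q" for h using that w(2) prime_idealD(3)[OF P(2)] by blast
    moreover have "u \<noteq> 0" using u(1) by auto
    ultimately have "Q = UNIV"
      using poisson_ideal_coprime_pair[OF P(1) w(1) _ u(2) that] by blast
    then show False using w(2) by blast
  qed
  moreover have "g \<in> Q" if "u dvd g" for g
    using that u(2) prime_idealD(1)[OF P(2)] by (auto intro: ideal_mult_right)
  ultimately have "Q = principal_ideal u" by (auto simp: mem_principal_ideal)
  then show ?thesis using u by blast
qed simp

section \<open>The Poisson Dixmier-Moeglin equivalence\<close>

text \<open>Subtracting from \<open>a/b\<close> its value at the point gives a central fraction with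
  numerator \<open>e\<close> vanishing there. Enlarging \<open>P\<close> by \<open>e\<close> and
  saturating at \<open>b\<close> gives a Poisson ideal inside the maximal ideal, and the core
  absorbs it.\<close>

lemma central_fraction_scalar:
  assumes core: "is_poisson_core s t (max_ideal_at \<alpha> \<beta> \<gamma>) P" and P: "is_prime_ideal P"
    and central: "frac_poisson_central s t P a b" and b: "b \<notin> max_ideal_at \<alpha> \<beta> \<gamma>"
  shows "\<exists>c. a - const3 c * b \<in> P"
proof -
  let ?M = "max_ideal_at \<alpha> \<beta> \<gamma>"
  define c where "c = eval3 a \<alpha> \<beta> \<gamma> / eval3 b \<alpha> \<beta> \<gamma>"
  define e where "e = a - const3 c * b"
  have eM: "e \<in> ?M" using b by (simp add: e_def c_def max_ideal_at_eq)
  have PM: "poisson_ideal s t P" "P \<subseteq> ?M" and max: "\<And>Q. poisson_ideal s t Q \<Longrightarrow> Q \<subseteq> ?M \<Longrightarrow> Q \<subseteq> P"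
    using core by (auto simp: is_poisson_core_def)
  note ideal = prime_idealD(1)[OF P]
  \<comment> \<open>Centrality tested against \<open>g/1\<close>: this is the numerator given by the
    quotient rule for the bracket of \<open>g\<close> with \<open>e/b\<close>.\<close>
  have cross: "b * pbr s t g e - e * pbr s t g b \<in> P" for g
  proof -
    have one: "pbr s t f 1 = 0" for f using pbr_const[of s t f 1] by (simp add: const3_simps)
    have "frac_bracket_num s t a b g 1 \<in> P"
      using central prime_idealD(2)[OF P] by (auto simp: frac_poisson_central_def)
    then have "- (pbr s t a g * b - pbr s t b g * a) \<in> P"
      unfolding frac_bracket_num_def one by (intro ideal_minus[OF ideal]) simp
    moreover have "- (pbr s t a g * b - pbr s t b g * a) = b * pbr s t g e - e * pbr s t g b"
      unfolding e_def pbr_diff pbr_mult pbr_const pbr_swap[of s t a g] pbr_swap[of s t b g]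
      by (simp add: algebra_simps)
    ultimately show ?thesis by simp
  qed
  let ?I = "{n + k * e | n k. n \<in> P}"
  note I = adjoin_principal[OF ideal, of e]
  have "b * pbr s t g h \<in> ?I" if "h \<in> ?I" for g h
  proof -
    obtain n k where h: "h = n + k * e" "n \<in> P" using \<open>h \<in> ?I\<close> by blast
    \<comment> \<open>The terms are grouped so that the first part lies in \<open>P\<close> and the
      rest is a multiple of \<open>e\<close>.\<close>
    have "b * pbr s t g h = (b * pbr s t g n + k * (b * pbr s t g e - e * pbr s t g b))
        + (k * pbr s t g b + b * pbr s t g k) * e"
      unfolding h(1) pbr_add pbr_mult by algebra
    moreover have "b * pbr s t g n + k * (b * pbr s t g e - e * pbr s t g b) \<in> P"
      by (intro ideal_add[OF ideal] ideal_mult[OF ideal] cross poisson_idealD(2)[OF PM(1)] h(2))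
    ultimately show ?thesis by blast
  qed
  then have "poisson_ideal s t (saturation b ?I)" by (rule poisson_saturation[OF I(1)])
  moreover have "?I \<subseteq> ?M" using PM(2) eM by (auto intro!: ideal_add ideal_mult is_ideal_max_ideal_at)
  then have "saturation b ?I \<subseteq> ?M"
    by (rule saturation_subset_prime[OF is_prime_ideal_max_ideal_at _ b])
  ultimately have "saturation b ?I \<subseteq> P" by (rule max)
  then have "e \<in> P" using I(3) subset_saturation[of ?I b] by blast
  then show ?thesis by (auto simp: e_def)
qed

text \<open>The element \<open>w\<close> separates: the core at a point of \<open>u = 0\<close> off
  \<open>w = 0\<close> is the ideal of \<open>u\<close>, and every strictly larger Poisson prime
  contains \<open>w\<close>. For rationality the point must also avoid the zeros of the
  denominator.\<close>

lemma height_one_properties: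
  assumes u: "irreducible u" "poisson_ideal s t (principal_ideal u)"
    and w: "w \<in> wronskians s t" "\<not> u dvd w"
  shows "poisson_primitive s t (principal_ideal u)" "locally_closed s t (principal_ideal u)"
    "poisson_rational s t (principal_ideal u)"
proof -
  let ?P = "principal_ideal u"
  have prime: "is_prime_ideal ?P" by (rule is_prime_ideal_principal[OF u(1)])
  have pp: "poisson_prime s t ?P" using prime u(2) by (simp add: poisson_prime_def)
  have wP: "w \<notin> ?P" using w(2) by (simp add: mem_principal_ideal)
  obtain \<alpha> \<beta> \<gamma> where "?P \<subseteq> max_ideal_at \<alpha> \<beta> \<gamma>" "w \<notin> max_ideal_at \<alpha> \<beta> \<gamma>"
    by (rule prime_nullstellensatz[OF prime wP])
  then have "is_poisson_core s t (max_ideal_at \<alpha> \<beta> \<gamma>) ?P"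
    by (rule core_of_generic_point[OF u w(1) is_prime_ideal_max_ideal_at])
  then show "poisson_primitive s t ?P"
    using pp is_maximal_ideal_max_ideal_at unfolding poisson_primitive_def by blast
  \<comment> \<open>Otherwise \<open>Q\<close> would be generated by an irreducible divisor of
    \<open>u\<close>, hence by \<open>u\<close> itself.\<close>
  have "w \<in> Q" if Q: "poisson_prime s t Q" "?P \<subset> Q" for Q
  proof (rule ccontr)
    assume "w \<notin> Q"
    have "u \<in> Q" using Q(2) mem_principal_ideal dvd_refl by blast
    moreover have "u \<noteq> 0" using u(1) by auto
    ultimately obtain v where v: "irreducible v" "Q = principal_ideal v"
      using poisson_prime_height_le_1[OF Q(1) w(1) \<open>w \<notin> Q\<close>] by blast
    then have "v dvd u" using \<open>u \<in> Q\<close> by (simp add: mem_principal_ideal)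
    then have "u dvd v" using u(1) v(1) by (meson irreducibleD' irreducible_not_unit)
    then have "Q \<subseteq> ?P" using v(2) by (auto simp: mem_principal_ideal intro: dvd_trans)
    then show False using Q(2) by blast
  qed
  then have "?P \<noteq> \<Inter>{Q. poisson_prime s t Q \<and> ?P \<subset> Q}" using wP by blast
  then show "locally_closed s t ?P" using pp by (simp add: locally_closed_def)
  have "\<exists>c. a - const3 c * b \<in> ?P" if ab: "frac_poisson_central s t ?P a b" for a b
  proof -
    have "b \<notin> ?P" using ab by (simp add: frac_poisson_central_def)
    \<comment> \<open>A point off the product keeps both \<open>w\<close> and the denominator
      \<open>b\<close> nonzero.\<close>
    then have "w * b \<notin> ?P" using wP prime_idealD(3)[OF prime] by blast
    then obtain \<alpha> \<beta> \<gamma> where M: "?P \<subseteq> max_ideal_at \<alpha> \<beta> \<gamma>" "w * b \<notin> max_ideal_at \<alpha> \<beta> \<gamma>"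
      by (rule prime_nullstellensatz[OF prime])
    have wb: "w \<notin> max_ideal_at \<alpha> \<beta> \<gamma>" "b \<notin> max_ideal_at \<alpha> \<beta> \<gamma>"
      using M(2) by (auto simp: max_ideal_at_eq)
    have "is_poisson_core s t (max_ideal_at \<alpha> \<beta> \<gamma>) ?P"
      by (rule core_of_generic_point[OF u w(1) is_prime_ideal_max_ideal_at M(1) wb(1)])
    then show ?thesis by (rule central_fraction_scalar[OF _ prime ab wb(2)])
  qed
  then show "poisson_rational s t ?P" using pp by (simp add: poisson_rational_def)
qed

text \<open>If \<open>u\<close> divided every Wronskian, it would divide all derivatives of the
  pencil member up to a factor coprime to \<open>u\<close>. As \<open>u\<close> is a simple factor,
  it would then divide its own derivatives, which forces it to be constant.\<close>

lemma simple_factor_wronskian: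
  assumes "coprime s t" and u: "irreducible u" and nz: "(la, mu) \<noteq> (0, 0)"
    and f: "u dvd pencil s t la mu" "\<not> u * u dvd pencil s t la mu"
  shows "\<exists>w\<in>wronskians s t. \<not> u dvd w"
proof (rule ccontr)
  assume "\<not> ?thesis"
  then have all: "u dvd wronskian D s t" if "D \<in> {dX, dY, dZ}" for D
    using that by (auto simp: wronskians_def)
  obtain v where v: "pencil s t la mu = u * v" using f(1) by (elim dvdE)
  have "\<not> u dvd v" using f(2) by (auto simp: v)
  have not_unit: "\<not> is_unit u" using u by (rule irreducible_not_unit)
  note prime = prime_elem_dvd_mult_iff[OF irreducible_imp_prime_elem[OF u]]
  \<comment> \<open>Here \<open>q\<close> is \<open>t\<close> if \<open>la\<close> is nonzero and
    \<open>s\<close> otherwise; if \<open>u\<close> divided \<open>q\<close> it would be a common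
    factor of \<open>s\<close> and \<open>t\<close>.\<close>
  have "\<exists>q. \<not> u dvd q \<and> (\<forall>D\<in>{dX, dY, dZ}. u dvd q * D (pencil s t la mu))"
  proof (cases "la = 0")
    case False
    have "\<not> u dvd t"
    proof
      assume ut: "u dvd t"
      then have "u dvd pencil s t la mu + const3 mu * t" using f(1) by simp
      then have "u dvd s" using False by (simp add: pencil_def const3_dvd_cancel)
      then show False using coprime_common_divisor[OF assms(1) _ ut] not_unit by blast
    qed
    moreover have "u dvd t * D (pencil s t la mu)" if "D \<in> {dX, dY, dZ}" for D
    proof -
      have "t * D (pencil s t la mu) = const3 la * wronskian D s t + pencil s t la mu * D t"
        using wronskian_pencil(1)[OF that, of t s la mu] by (simp add: algebra_simps)
      then show ?thesis using all[OF that] f(1) by simp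
    qed
    ultimately show ?thesis by blast
  next
    case True
    have "\<not> u dvd s"
    proof
      assume us: "u dvd s"
      have "u dvd const3 mu * t" using f(1) True by (simp add: pencil_def const3_simps)
      then have "u dvd t" using True nz by (simp add: const3_dvd_cancel)
      then show False using coprime_common_divisor[OF assms(1) us] not_unit by blast
    qed
    moreover have "u dvd s * D (pencil s t la mu)" if "D \<in> {dX, dY, dZ}" for D
    proof -
      have "s * D (pencil s t la mu) = const3 mu * wronskian D s t + pencil s t la mu * D s"
        using wronskian_pencil(2)[OF that, of s t la mu] by (simp add: algebra_simps)
      then show ?thesis using all[OF that] f(1) by simp
    qed
    ultimately show ?thesis by blast
  qed
  then obtain q where q: "\<not> u dvd q" "\<And>D. D \<in> {dX, dY, dZ} \<Longrightarrow> u dvd q * D (pencil s t la mu)"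
    by blast
  have "D u = 0" if D: "D \<in> {dX, dY, dZ}" for D
  proof -
    interpret derivation D using D by (rule derivation_member)
    have "u dvd D u * v + u * D v" using q(2)[OF D] q(1) unfolding v mult prime by blast
    then have "u dvd D u * v" by (simp add: dvd_add_left_iff)
    then have "u dvd D u" using \<open>\<not> u dvd v\<close> prime by blast
    then show ?thesis by (rule dvd_derivative_imp_zero[OF D])
  qed
  then obtain c where "u = const3 c" using const3_if_derivatives_zero[of u] by blast
  moreover have "u \<noteq> 0" using u by auto
  ultimately show False using not_unit is_unit_const3[of c] by auto
qed

section \<open>Poisson maximal ideals and the pencil\<close>

lemma multiplicity_eq_1_iff:
  fixes u f :: cpoly3
  assumes "\<not> is_unit u" "f \<noteq> 0"
  shows "multiplicity u f = 1 \<longleftrightarrow> u dvd f \<and> \<not> u * u dvd f"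
  using power_dvd_iff_le_multiplicity[OF assms(2,1), of 1]
    power_dvd_iff_le_multiplicity[OF assms(2,1), of 2]
  by (auto simp: power2_eq_square)

lemma poisson_maximal_iff:
  "poisson_maximal s t M \<longleftrightarrow> (\<exists>\<alpha> \<beta> \<gamma>. M = max_ideal_at \<alpha> \<beta> \<gamma> \<and>
     ((eval3 s \<alpha> \<beta> \<gamma> = 0 \<and> eval3 t \<alpha> \<beta> \<gamma> = 0) \<or>
      (\<exists>la mu. (la, mu) \<noteq> (0, 0) \<and> singular_point (pencil s t la mu) \<alpha> \<beta> \<gamma>)))"
proof -
  have key: "wronskians s t \<subseteq> max_ideal_at \<alpha> \<beta> \<gamma> \<longleftrightarrow>
     ((eval3 s \<alpha> \<beta> \<gamma> = 0 \<and> eval3 t \<alpha> \<beta> \<gamma> = 0) \<or>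
      (\<exists>la mu. (la, mu) \<noteq> (0, 0) \<and> singular_point (pencil s t la mu) \<alpha> \<beta> \<gamma>))"
    (is "?W \<longleftrightarrow> ?Z \<or> ?S") for \<alpha> \<beta> \<gamma>
  proof -
    let ?e = "\<lambda>f. eval3 f \<alpha> \<beta> \<gamma>"
    have W: "?W \<longleftrightarrow> (\<forall>D\<in>{dX, dY, dZ}. ?e t * ?e (D s) = ?e s * ?e (D t))"
      by (auto simp: wronskians_def wronskian_def max_ideal_at_eq)
    have S: "singular_point (pencil s t la mu) \<alpha> \<beta> \<gamma> \<longleftrightarrow> la * ?e s = mu * ?e t \<and>
        (\<forall>D\<in>{dX, dY, dZ}. la * ?e (D s) = mu * ?e (D t))" for la mu
      by (auto simp: singular_point_def derivative_pencil) (simp_all add: pencil_def)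
    show ?thesis
    proof
      assume ?W
      \<comment> \<open>The parameters are the values of \<open>t\<close> and \<open>s\<close> at
        the point. They form an admissible pair unless both vanish, which is the other
        alternative.\<close>
      then have "singular_point (pencil s t (?e t) (?e s)) \<alpha> \<beta> \<gamma>"
        unfolding S W by (simp add: mult.commute)
      then show "?Z \<or> ?S" by auto
    next
      assume "?Z \<or> ?S"
      then show ?W
      proof
        assume ?S
        then obtain la mu where nz: "(la, mu) \<noteq> (0, 0)" and eq: "la * ?e s = mu * ?e t"
          "\<And>D. D \<in> {dX, dY, dZ} \<Longrightarrow> la * ?e (D s) = mu * ?e (D t)" unfolding S by blast
        have "?e t * ?e (D s) = ?e s * ?e (D t)" if "D \<in> {dX, dY, dZ}" for D
        proof -
          have "la * (?e t * ?e (D s)) = la * (?e s * ?e (D t))"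
            "mu * (?e t * ?e (D s)) = mu * (?e s * ?e (D t))"
            using eq(1) eq(2)[OF that] by algebra+
          then show ?thesis using nz by auto
        qed
        then show ?W unfolding W by blast
      qed (simp add: W)
    qed
  qed
  show ?thesis
    unfolding key[symmetric] poisson_maximal_def maximal_ideal_iff poisson_max_ideal_at_iff[symmetric]
    by blast
qed

section \<open>Primitive ideals and primes with zero induced bracket\<close>

lemma poisson_maximal_imp_primitive:
  assumes "poisson_maximal s t M"
  shows "poisson_primitive s t M"
proof -
  have "is_maximal_ideal M" "poisson_ideal s t M" using assms by (auto simp: poisson_maximal_def)
  moreover from this(1) have "is_prime_ideal M"
    by (auto simp: maximal_ideal_iff is_prime_ideal_max_ideal_at)
  ultimately show ?thesis
    unfolding poisson_primitive_def poisson_prime_def is_poisson_core_def by blast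
qed

text \<open>The maximal ideal above \<open>P\<close> contains the Wronskians too, so it is Poisson
  and its own core.\<close>

lemma primitive_with_zero_bracket:
  assumes "poisson_primitive s t P" "wronskians s t \<subseteq> P"
  shows "poisson_maximal s t P"
proof -
  obtain M where M: "is_maximal_ideal M" "is_poisson_core s t M P"
    using assms(1) by (auto simp: poisson_primitive_def)
  then have "wronskians s t \<subseteq> M" using assms(2) by (auto simp: is_poisson_core_def)
  then have "poisson_ideal s t M"
    using M(1) by (intro poisson_ideal_if_wronskians) (auto simp: is_maximal_ideal_def)
  moreover from this have "P = M" using M(2) unfolding is_poisson_core_def by blast
  ultimately show ?thesis using M(1) by (simp add: poisson_maximal_def)
qed

text \<open>The member vanishing at the chosen point generates a Poisson ideal inside the maximal
  ideal, hence inside its core.\<close>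

lemma primitive_contains_pencil:
  assumes "poisson_primitive s t P"
  shows "\<exists>la mu. (la, mu) \<noteq> (0, 0) \<and> pencil s t la mu \<in> P"
proof -
  obtain M where M: "is_maximal_ideal M" "is_poisson_core s t M P"
    using assms by (auto simp: poisson_primitive_def)
  obtain \<alpha> \<beta> \<gamma> where at: "M = max_ideal_at \<alpha> \<beta> \<gamma>" using M(1) by (auto simp: maximal_ideal_iff)
  obtain la mu where lm: "(la, mu) \<noteq> (0, 0)" "eval3 (pencil s t la mu) \<alpha> \<beta> \<gamma> = 0"
    using pencil_through_point by blast
  then have "principal_ideal (pencil s t la mu) \<subseteq> M"
    by (auto simp: at max_ideal_at_eq principal_ideal_def)
  then have "principal_ideal (pencil s t la mu) \<subseteq> P"
    using poisson_pencil M(2) unfolding is_poisson_core_def by blast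
  then have "pencil s t la mu \<in> P" by (auto simp: mem_principal_ideal)
  then show ?thesis using lm(1) by blast
qed

text \<open>Every prime above \<open>P\<close> is Poisson and every fraction is central. By the
  Nullstellensatz a non-maximal \<open>P\<close> is the intersection of the maximal ideals above it,
  and rationality makes each coordinate a scalar modulo \<open>P\<close>.\<close>

lemma zero_bracket_equivalences:
  assumes P: "poisson_prime s t P" and W: "wronskians s t \<subseteq> P"
  shows "locally_closed s t P \<longleftrightarrow> poisson_maximal s t P"
    and "poisson_rational s t P \<longleftrightarrow> poisson_maximal s t P"
proof -
  have prime: "is_prime_ideal P" and pideal: "poisson_ideal s t P"
    using P by (auto simp: poisson_prime_def)
  note ideal = prime_idealD(1)[OF prime]
  have max: "poisson_maximal s t P \<longleftrightarrow> (\<exists>\<alpha> \<beta> \<gamma>. P = max_ideal_at \<alpha> \<beta> \<gamma>)"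
    using pideal maximal_ideal_iff by (auto simp: poisson_maximal_def)
  show "locally_closed s t P \<longleftrightarrow> poisson_maximal s t P"
  proof
    assume lc: "locally_closed s t P"
    show "poisson_maximal s t P"
    proof (rule ccontr)
      assume nm: "\<not> poisson_maximal s t P"
      have "f \<in> P" if f: "f \<in> \<Inter>{Q. poisson_prime s t Q \<and> P \<subset> Q}" for f
      proof (rule ccontr)
        assume "f \<notin> P"
        then obtain \<alpha> \<beta> \<gamma> where M: "P \<subseteq> max_ideal_at \<alpha> \<beta> \<gamma>" "f \<notin> max_ideal_at \<alpha> \<beta> \<gamma>"
          by (rule prime_nullstellensatz[OF prime])
        have "poisson_prime s t (max_ideal_at \<alpha> \<beta> \<gamma>)"
          using W M(1) is_prime_ideal_max_ideal_at
          by (auto simp: poisson_prime_def intro!: poisson_ideal_if_wronskians is_ideal_max_ideal_at)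
        moreover have "P \<subset> max_ideal_at \<alpha> \<beta> \<gamma>" using M(1) nm max by blast
        ultimately show False using f M(2) by blast
      qed
      then have "P = \<Inter>{Q. poisson_prime s t Q \<and> P \<subset> Q}" by blast
      then show False using lc by (simp add: locally_closed_def)
    qed
  next
    assume "poisson_maximal s t P"
    \<comment> \<open>Nothing proper lies above a maximal ideal, and the empty intersection is
      \<open>UNIV\<close>.\<close>
    then have "{Q. poisson_prime s t Q \<and> P \<subset> Q} = {}"
      by (auto simp: poisson_maximal_def is_maximal_ideal_def poisson_prime_def is_prime_ideal_def)
    moreover have "P \<noteq> UNIV" using prime by (simp add: is_prime_ideal_def)
    ultimately have "P \<noteq> \<Inter>{Q. poisson_prime s t Q \<and> P \<subset> Q}" 
      by (simp only: Inter_empty not_False_eq_True)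
    then show "locally_closed s t P" using P by (simp add: locally_closed_def)
  qed
  show "poisson_rational s t P \<longleftrightarrow> poisson_maximal s t P"
  proof
    assume rat: "poisson_rational s t P"
    have "frac_bracket_num s t a b c d \<in> P" for a b c d
      unfolding frac_bracket_num_def
      by (intro ideal_add[OF ideal] ideal_diff[OF ideal] ideal_mult_right[OF ideal]
          pbr_in_ideal[OF ideal W])
    then have "frac_poisson_central s t P a 1" for a
      using prime_idealD(2)[OF prime] by (simp add: frac_poisson_central_def)
    then have "\<exists>c. a - const3 c \<in> P" for a
      using rat unfolding poisson_rational_def by (metis mult_1_right)
    then obtain \<alpha> \<beta> \<gamma> where "varX - const3 \<alpha> \<in> P" "varY - const3 \<beta> \<in> P" "varZ - const3 \<gamma> \<in> P"
      by blast
    then have "max_ideal_at \<alpha> \<beta> \<gamma> \<subseteq> P" by (rule max_ideal_at_subset_ideal[OF ideal])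
    then have "P = max_ideal_at \<alpha> \<beta> \<gamma>"
      using prime is_maximal_ideal_max_ideal_at[of \<alpha> \<beta> \<gamma>]
      unfolding is_maximal_ideal_def is_prime_ideal_def by blast
    then show "poisson_maximal s t P" using max by blast
  next
    assume "poisson_maximal s t P"
    then obtain \<alpha> \<beta> \<gamma> where at: "P = max_ideal_at \<alpha> \<beta> \<gamma>" using max by blast
    have "\<exists>c. a - const3 c * b \<in> P" if "b \<notin> P" for a b
      using that
      by (intro exI[where x = "eval3 a \<alpha> \<beta> \<gamma> / eval3 b \<alpha> \<beta> \<gamma>"]) (simp add: at max_ideal_at_eq)
    then show "poisson_rational s t P"
      using P by (auto simp: poisson_rational_def frac_poisson_central_def)
  qed
qed

section \<open>The zero ideal\<close>

text \<open>The members of the pencil are pairwise coprime, so their prime factors give infinitely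
  many Poisson primes of height one.\<close>

lemma zero_not_locally_closed:
  assumes cop: "coprime s t" and w: "w \<in> wronskians s t" "w \<noteq> 0"
  shows "\<not> locally_closed s t {0}"
proof
  assume lc: "locally_closed s t {0}"
  then obtain a where a: "a \<noteq> 0" "\<And>Q. poisson_prime s t Q \<Longrightarrow> {0} \<subset> Q \<Longrightarrow> a \<in> Q"
  proof -
    have "{0} \<subseteq> \<Inter>{Q. poisson_prime s t Q \<and> {0} \<subset> Q}" by blast
    then have "\<exists>a\<in>\<Inter>{Q. poisson_prime s t Q \<and> {0} \<subset> Q}. a \<noteq> 0"
      using lc unfolding locally_closed_def by blast
    then show thesis using that by blast
  qed
  have nz: "pencil s t 1 c \<noteq> 0" for c
    using wronskians_zero_if_pencil_zero[of 1 c s t] w by auto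
  have cross: "u dvd t \<and> u dvd s" if "u dvd pencil s t 1 c" "u dvd pencil s t 1 d" "c \<noteq> d" for u c d
  proof -
    have "u dvd pencil s t 1 c - pencil s t 1 d" using that by (intro dvd_diff)
    then have "u dvd const3 (d - c) * t" by (simp add: pencil_def const3_simps algebra_simps)
    then have "u dvd t" using that(3) by (simp add: const3_dvd_cancel)
    moreover from this have "u dvd pencil s t 1 c + const3 c * t" using that(1) by simp
    ultimately show ?thesis by (simp add: pencil_def const3_simps)
  qed
  define U where "U = {c. is_unit (pencil s t 1 c)}"
  have "finite U"
  proof (rule ccontr)
    assume "infinite U"
    then obtain c d where cd: "c \<in> U" "d \<in> U" "c \<noteq> d"
      by (metis finite.emptyI finite.insertI finite_subset insertCI subsetI)
    then obtain x y where x: "pencil s t 1 c = const3 x" and y: "pencil s t 1 d = const3 y"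
      using is_unit_imp_const3 unfolding U_def by blast
    \<comment> \<open>Two constant members make \<open>t\<close> the constant \<open>z\<close>; the
      member with parameter \<open>c + x / z\<close> is then zero.\<close>
    define z where "z = (x - y) / (d - c)"
    have "const3 (d - c) * t = const3 (x - y)"
      unfolding const3_simps x[symmetric] y[symmetric] by (simp add: pencil_def const3_simps algebra_simps)
    also have "\<dots> = const3 (d - c) * const3 z" using cd(3) by (simp add: z_def flip: const3_simps(2))
    finally have t: "t = const3 z" using cd(3) by simp
    have "t \<noteq> 0" using wronskians_zero_if_pencil_zero[of 0 1 s t] w
      by (auto simp: pencil_def const3_simps)
    then have "z \<noteq> 0" using t by auto
    have "pencil s t 1 (c + x / z) = pencil s t 1 c - const3 (x / z) * t"
      by (simp add: pencil_def const3_simps algebra_simps)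
    also have "const3 (x / z) * t = const3 x"
      using t \<open>z \<noteq> 0\<close> by (simp flip: const3_simps(2))
    finally show False using nz x by simp
  qed
  have "\<exists>u. prime u \<and> u dvd pencil s t 1 c" if "c \<notin> U" for c
    using that nz[of c] prime_divisor_exists[of "pencil s t 1 c"] by (auto simp: U_def)
  then obtain u where u: "\<And>c. c \<notin> U \<Longrightarrow> prime (u c) \<and> u c dvd pencil s t 1 c" by metis
  \<comment> \<open>The nonzero \<open>a\<close> lies in all these principal primes but has only
    finitely many prime factors.\<close>
  have "u c \<in> prime_factors a" if "c \<notin> U" for c
  proof -
    have irr: "irreducible (u c)" 
      using u[OF that] by (blast intro: prime_elem_imp_irreducible prime_imp_prime_elem)
    have "poisson_prime s t (principal_ideal (u c))"
      using poisson_irreducible_factor[OF irr, of 1 c s t] u[OF that] is_prime_ideal_principal[OF irr]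
      by (simp add: poisson_prime_def)
    moreover have "{0} \<subset> principal_ideal (u c)"
    proof -
      have "u c \<noteq> 0" using irr by auto
      then have "u c \<in> principal_ideal (u c)" "u c \<notin> {0}" "0 \<in> principal_ideal (u c)"
        by (auto simp: mem_principal_ideal)
      then show ?thesis by blast
    qed
    ultimately have "u c dvd a" using a(2) mem_principal_ideal by blast
    then show ?thesis using u[OF that] a(1) by (simp add: in_prime_factors_iff)
  qed
  then have "u ` (- U) \<subseteq> prime_factors a" by blast
  moreover have "inj_on u (- U)"
  proof (rule inj_onI, rule ccontr)
    fix c d assume cd: "c \<in> - U" "d \<in> - U" "u c = u d" "c \<noteq> d"
    then have "u c dvd t \<and> u c dvd s" using cross[of "u c" c d] u[of c] u[of d] by simp
    then have "is_unit (u c)" using coprime_common_divisor[OF cop] by blast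
    then show False using u[of c] cd(1) not_prime_unit by blast
  qed
  ultimately have "finite (- U)" using finite_imageD finite_subset by (metis finite_set_mset)
  then have "finite (UNIV :: complex set)" using \<open>finite U\<close> by (metis Compl_partition finite_Un)
  then show False using infinite_UNIV_char_0 by blast
qed

text \<open>The fraction \<open>s/t\<close> is central because \<open>s\<close> and \<open>t\<close>
  have the same cofactor; were it a scalar, a member of the pencil would vanish.\<close>

lemma zero_not_rational:
  assumes "w \<in> wronskians s t" "w \<noteq> 0"
  shows "\<not> poisson_rational s t {0}"
proof
  assume rat: "poisson_rational s t {0}"
  have nz: "pencil s t la mu \<noteq> 0" if "(la, mu) \<noteq> (0, 0)" for la mu
    using wronskians_zero_if_pencil_zero[OF that] assms by auto
  have "pbr s t s c = s * jac c s t" "pbr s t t c = t * jac c s t" for c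
    \<comment> \<open>\<open>s\<close> and \<open>t\<close> are the members with parameters
      \<open>1\<close>, \<open>0\<close> and \<open>0\<close>, \<open>- 1\<close>.\<close>
    using pbr_pencil[of s t c 1 0] pbr_pencil[of s t c 0 "- 1"] pbr_swap[of s t s c] pbr_swap[of s t t c]
    by (simp_all add: pencil_def const3_simps)
  then have "frac_bracket_num s t s t c d = 0" for c d
    by (simp add: frac_bracket_num_def algebra_simps)
  moreover have "t \<noteq> 0" using nz[of 0 1] by (auto simp: pencil_def const3_simps)
  ultimately have "frac_poisson_central s t {0} s t" by (simp add: frac_poisson_central_def)
  then obtain c where "s - const3 c * t = 0" using rat by (auto simp: poisson_rational_def)
  then show False using nz[of 1 c] by (simp add: pencil_def const3_simps)
qed

lemma zero_not_primitive:
  assumes "w \<in> wronskians s t" "w \<noteq> 0"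
  shows "\<not> poisson_primitive s t {0}"
  using primitive_contains_pencil[of s t "{0}"] wronskians_zero_if_pencil_zero assms by blast

section \<open>The classification and the equivalence\<close>

lemma poisson_primitive_iff:
  assumes "coprime s t"
  shows "poisson_primitive s t P \<longleftrightarrow>
    (poisson_maximal s t P \<or>
     (\<exists>u la mu. (la, mu) \<noteq> (0, 0) \<and> pencil s t la mu \<noteq> 0 \<and> \<not> is_unit (pencil s t la mu) \<and>
        irreducible u \<and> multiplicity u (pencil s t la mu) = 1 \<and> P = principal_ideal u))"
    (is "_ \<longleftrightarrow> _ \<or> ?U")
proof
  assume prim: "poisson_primitive s t P"
  then have pp: "poisson_prime s t P" by (simp add: poisson_primitive_def)
  show "poisson_maximal s t P \<or> ?U"
  proof (cases "wronskians s t \<subseteq> P")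
    case True
    then show ?thesis using primitive_with_zero_bracket[OF prim] by blast
  next
    case False
    then obtain w where w: "w \<in> wronskians s t" "w \<notin> P" by blast
    have "0 \<in> P" using pp by (auto simp: poisson_prime_def poisson_ideal_def is_ideal_def)
    then have "w \<noteq> 0" using w(2) by blast
    then have "P \<noteq> {0}" using zero_not_primitive[OF w(1)] prim by blast
    then obtain u where u: "irreducible u" "P = principal_ideal u"
      using poisson_prime_height_le_1[OF pp w] by blast
    obtain la mu where lm: "(la, mu) \<noteq> (0, 0)" "u dvd pencil s t la mu"
      using primitive_contains_pencil[OF prim] u(2) by (auto simp: mem_principal_ideal)
    have not_unit: "\<not> is_unit u" using u(1) by (rule irreducible_not_unit)
    have nz: "pencil s t la mu \<noteq> 0"
      using wronskians_zero_if_pencil_zero[OF lm(1)] w(1) \<open>w \<noteq> 0\<close> by blast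
    have "\<not> u * u dvd pencil s t la mu"
      using square_dvd_imp_dvd_wronskian[OF w(1) lm(1)] w(2) u(2) by (auto simp: mem_principal_ideal)
    then have "multiplicity u (pencil s t la mu) = 1"
      using multiplicity_eq_1_iff[OF not_unit nz] lm(2) by blast
    moreover have "\<not> is_unit (pencil s t la mu)" using lm(2) not_unit dvd_trans by blast
    ultimately show ?thesis using u lm nz by blast
  qed
next
  assume "poisson_maximal s t P \<or> ?U"
  then show "poisson_primitive s t P"
  proof
    assume ?U
    then obtain u la mu where u: "(la, mu) \<noteq> (0, 0)" "pencil s t la mu \<noteq> 0" "irreducible u"
      "multiplicity u (pencil s t la mu) = 1" "P = principal_ideal u" by blast
    then have dvd: "u dvd pencil s t la mu" "\<not> u * u dvd pencil s t la mu"
      using multiplicity_eq_1_iff[OF irreducible_not_unit[OF u(3)] u(2)] by blast+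
    obtain w where "w \<in> wronskians s t" "\<not> u dvd w"
      using simple_factor_wronskian[OF assms u(3,1) dvd] by blast
    then show ?thesis
      using height_one_properties(1)[OF u(3) poisson_irreducible_factor[OF u(3,1) dvd(1)]] u(5) by blast
  qed (rule poisson_maximal_imp_primitive)
qed

text \<open>If \<open>P\<close> contains the Wronskians, all three properties amount to maximality.
  Otherwise all three fail for the zero ideal and all three hold in height one.\<close>

lemma poisson_dixmier_moeglin:
  assumes "coprime s t" and P: "poisson_prime s t P"
  shows "locally_closed s t P \<longleftrightarrow> poisson_primitive s t P"
    and "poisson_primitive s t P \<longleftrightarrow> poisson_rational s t P"
proof -
  have "(locally_closed s t P \<longleftrightarrow> poisson_primitive s t P) \<and>
      (poisson_primitive s t P \<longleftrightarrow> poisson_rational s t P)"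
  proof (cases "wronskians s t \<subseteq> P")
    case True
    then show ?thesis
      using zero_bracket_equivalences[OF P True] primitive_with_zero_bracket[OF _ True]
        poisson_maximal_imp_primitive by blast
  next
    case False
    then obtain w where w: "w \<in> wronskians s t" "w \<notin> P" by blast
    show ?thesis
    proof (cases "P = {0}")
      case True
      then show ?thesis
        using w zero_not_locally_closed[OF assms(1) w(1)] zero_not_primitive[OF w(1)]
          zero_not_rational[OF w(1)] by auto
    next
      case False
      then obtain u where u: "irreducible u" "P = principal_ideal u"
        using poisson_prime_height_le_1[OF P w] by blast
      then show ?thesis
        using height_one_properties[OF u(1) _ w(1)] P w(2)
        by (auto simp: poisson_prime_def mem_principal_ideal)
    qed
  qed
  then show "locally_closed s t P \<longleftrightarrow> poisson_primitive s t P"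
    "poisson_primitive s t P \<longleftrightarrow> poisson_rational s t P" by blast+
qed

theorem theorem3p7:
  fixes s t :: cpoly3
  assumes "s \<noteq> 0" and "t \<noteq> 0" and "coprime s t"
  shows "(\<forall>M. poisson_maximal s t M \<longleftrightarrow>
            (\<exists>\<alpha> \<beta> \<gamma>. M = max_ideal_at \<alpha> \<beta> \<gamma> \<and>
               ((eval3 s \<alpha> \<beta> \<gamma> = 0 \<and> eval3 t \<alpha> \<beta> \<gamma> = 0) \<or>
                (\<exists>la mu. (la, mu) \<noteq> (0, 0) \<and> singular_point (pencil s t la mu) \<alpha> \<beta> \<gamma>))))
    \<and> (\<forall>P. poisson_primitive s t P \<longleftrightarrow>
            (poisson_maximal s t P \<or>
             (\<exists>u la mu. (la, mu) \<noteq> (0, 0) \<and> pencil s t la mu \<noteq> 0 \<and> \<not> is_unit (pencil s t la mu) \<and>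
                irreducible u \<and> multiplicity u (pencil s t la mu) = 1 \<and>
                P = principal_ideal u)))
    \<and> (\<forall>P. poisson_prime s t P \<longrightarrow>
            (locally_closed s t P \<longleftrightarrow> poisson_primitive s t P) \<and>
            (poisson_primitive s t P \<longleftrightarrow> poisson_rational s t P))"
proof (intro conjI allI impI)
  fix M show "poisson_maximal s t M \<longleftrightarrow>
            (\<exists>\<alpha> \<beta> \<gamma>. M = max_ideal_at \<alpha> \<beta> \<gamma> \<and>
               ((eval3 s \<alpha> \<beta> \<gamma> = 0 \<and> eval3 t \<alpha> \<beta> \<gamma> = 0) \<or>
                (\<exists>la mu. (la, mu) \<noteq> (0, 0) \<and> singular_point (pencil s t la mu) \<alpha> \<beta> \<gamma>)))"
    by (rule poisson_maximal_iff)
next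
  fix P show "poisson_primitive s t P \<longleftrightarrow>
            (poisson_maximal s t P \<or>
             (\<exists>u la mu. (la, mu) \<noteq> (0, 0) \<and> pencil s t la mu \<noteq> 0 \<and> \<not> is_unit (pencil s t la mu) \<and>
                irreducible u \<and> multiplicity u (pencil s t la mu) = 1 \<and>
                P = principal_ideal u))"
    by (rule poisson_primitive_iff[OF assms(3)])
next
  fix P assume "poisson_prime s t P"
  then show "locally_closed s t P \<longleftrightarrow> poisson_primitive s t P"
    "poisson_primitive s t P \<longleftrightarrow> poisson_rational s t P"
    using poisson_dixmier_moeglin[OF assms(3)] by blast+
qed

end
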